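(* For every integer $n\ge 2$, the composition $\Psi\circ\Phi$ is a bijection between well-labelled Motzkin paths of size $n$ and matchings on $[2n-2]$. For every integer $n\ge1$, the composition $\Psi'\circ\Phi'$ is a bijection between well-labelled positive paths of size $n$ and matchings on $[2n]$.
   Context: A matching on $[2m]$ is a fixed-point-free involution of $\{1,\ldots,2m\}$. Well-labelled paths: a pair $(\mathbf{p},\sigma)$ with $\mathbf{p}=p_1\ldots p_{n-1}$ a word on $\{-1,0,+1\}$, $\sigma$ a permutation of $[n]$, $p_i=-1\Rightarrow\sigma_i<\sigma_{i+1}$, $p_i=1\Rightarrow\sigma_i>\sigma_{i+1}$; Motzkin if $\sum_{i\le j}p_i\ge0$ for $j\le n-2$ and $\sum_{i\le n-1}p_i=-1$; positive if $\sum_{i\le j}p_i\ge0$ for $j\le n-1$. A labelled binary tree of size $n$: rooted tree with $n$ leaves with distinct labels in $[n]$, unlabelled internal vertices each with two unordered children; a marked one has one marked vertex. $\lambda_I$ is the order-preserving bijection $[|I|]\to I$, and $\lambda(\tau)$ relabels leaves by $\lambda$. $\Phi$ (Motzkin paths of size $n\ge2$ to trees): $n=2$ gives a root with leaves $1,2$; for $n>2$, $p_1=0$: $\Phi$ is a root with subtrees a leaf $\sigma_1$ and $\lambda_{[n]\setminus\{\sigma_1\}}(\Phi(p_2\ldots p_{n-1},\sigma'))$ where $\sigma'_i=\lambda^{-1}_{[n]\setminus\{\sigma_1\}}(\sigma_{i+1})$; for $n>2$, $p_1=1$: with $k$ least such that $\sum_{i\le k}p_i=0$, $\Phi$ is a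 root with subtrees $\lambda_{I'}(\Phi(\mathbf{p}',\sigma'))$, $\lambda_{I''}(\Phi(\mathbf{p}'',\sigma''))$, where $I'=\{\sigma_1,\ldots,\sigma_k\}$, $I''=\{\sigma_{k+1},\ldots,\sigma_n\}$, $p'_i=-p_{k-i}$, $p''_i=p_{k+i}$, $\sigma'_i=\lambda^{-1}_{I'}(\sigma_{k+1-i})$, $\sigma''_i=\lambda^{-1}_{I''}(\sigma_{k+i})$. $\Phi'$ (positive paths to marked trees): $n=1$ gives a single marked leaf $1$; $n>1$, $p_1=0$: non-marked root with subtrees a non-marked leaf $\sigma_1$ and $\lambda_{[n]\setminus\{\sigma_1\}}(\Phi'(p_2\ldots p_{n-1},\sigma'))$; $n>1$, $p_1=1$: let $k$ be the greatest $k\le n$ with $\sum_{i=1}^{j-1}p_i\ge1$ for $j=2,\ldots,k-1$ and $\sum_{i=1}^{k-1}p_i=1$, with $I',I'',\mathbf{p}',\mathbf{p}'',\sigma',\sigma''$ as before for this $k$; if $k=n$, $\Phi'$ is $\Phi(\mathbf{p}',\sigma')$ with root marked; if $k<n$, it is a non-marked root with subtrees $\lambda_{I'}(\Phi(\mathbf{p}',\sigma'))$ (non-marked) and $\lambda_{I''}(\Phi'(\mathbf{p}'',\sigma''))$ (marked). $\Psi$ (trees of size $n$ to matchings on $[2n-2]$): label the $n-2$ internal non-root vertices: while unlabelled non-root vertices exist, among those whose two children are both labelled, pick the one having the child with the least label, and give it the least label in $[2n-2]\setminus[n]$ not yet used. Then $\Psi(\tau)$ is the matching pairing $i$ and $j$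 whenever they label two siblings. $\Psi'$ (marked trees of size $n$ to matchings on $[2n]$): let $\tau$ be the unmarked tree and $\pi=\Psi(\tau)$ (with the full labelling above). If the marked vertex is the root, $\pi'$ agrees with $\pi$ on $[2n-2]$ and pairs $2n-1$ with $2n$. Otherwise, if the marked vertex has label $k$ and its sibling label $l$, $\pi'$ agrees with $\pi$ off $\{k,l\}$, and $\pi'(k)=2n$, $\pi'(l)=2n-1$. *)

theory Defs
  imports Main
begin

text \<open>A matching on [N] (N = 2m) is a fixed-point-free involution of {1..N}.
  Represented as a function nat => nat which is the identity outside {1..N}
  (so that it is determined by its values on {1..N}).\<close>
definition matchings :: "nat \<Rightarrow> (nat \<Rightarrow> nat) set" where
  "matchings N = {\<pi>. (\<forall>i\<in>{1..N}. \<pi> i \<in> {1..N} \<and> \<pi> i \<noteq> i \<and> \<pi> (\<pi> i) = i)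
                      \<and> (\<forall>i. i \<notin> {1..N} \<longrightarrow> \<pi> i = i)}"

text \<open>A path of size n is a pair (p, sigma): p is a list of length n-1 (entry i is p_(i+1)),
  sigma a list of length n (entry i is sigma_(i+1)).\<close>
definition well_labelled :: "nat \<Rightarrow> int list \<Rightarrow> nat list \<Rightarrow> bool" where
  "well_labelled n p \<sigma> \<longleftrightarrow>
     length \<sigma> = n \<and> length p = n - 1 \<and> set p \<subseteq> {-1, 0, 1} \<and>
     distinct \<sigma> \<and> set \<sigma> = {1..n} \<and>
     (\<forall>i < n - 1. (p ! i = -1 \<longrightarrow> \<sigma> ! i < \<sigma> ! (i+1)) \<and> (p ! i = 1 \<longrightarrow> \<sigma> ! i > \<sigma> ! (i+1)))"

definition motzkin_paths :: "nat \<Rightarrow> (int list \<times> nat list) set" where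
  "motzkin_paths n = {(p, \<sigma>). well_labelled n p \<sigma> \<and>
      (\<forall>j. 1 \<le> j \<and> j \<le> n - 2 \<longrightarrow> sum_list (take j p) \<ge> 0) \<and> sum_list p = -1}"

definition positive_paths :: "nat \<Rightarrow> (int list \<times> nat list) set" where
  "positive_paths n = {(p, \<sigma>). well_labelled n p \<sigma> \<and>
      (\<forall>j. 1 \<le> j \<and> j \<le> n - 1 \<longrightarrow> sum_list (take j p) \<ge> 0)}"

text \<open>Trees are represented as ordered binary trees with labelled leaves; the maps
  below (Psi, Psi') do not depend on the order of children, so for the compositions
  this is harmless. A marked tree is a tree together with the position (root-to-node
  path; False = left child, True = right child) of its marked vertex.\<close>
datatype ltree = Leaf nat | Node ltree ltree

fun relabel :: "(nat \<Rightarrow> nat) \<Rightarrow> ltree \<Rightarrow> ltree" where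
  "relabel f (Leaf a) = Leaf (f a)"
| "relabel f (Node l r) = Node (relabel f l) (relabel f r)"

fun nleaves :: "ltree \<Rightarrow> nat" where
  "nleaves (Leaf a) = 1"
| "nleaves (Node l r) = nleaves l + nleaves r"

fun positions :: "ltree \<Rightarrow> bool list set" where
  "positions (Leaf a) = {[]}"
| "positions (Node l r) = {[]} \<union> Cons False ` positions l \<union> Cons True ` positions r"

fun subtree_at :: "ltree \<Rightarrow> bool list \<Rightarrow> ltree" where
  "subtree_at t [] = t"
| "subtree_at (Node l r) (b # q) = subtree_at (if b then r else l) q"
| "subtree_at (Leaf a) (b # q) = Leaf a"

definition sibling :: "bool list \<Rightarrow> bool list" where
  "sibling q = butlast q @ [\<not> last q]"

definition lam :: "nat set \<Rightarrow> nat \<Rightarrow> nat" where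
  "lam I k = sorted_list_of_set I ! (k - 1)"

definition lam_inv :: "nat set \<Rightarrow> nat \<Rightarrow> nat" where
  "lam_inv I x = card {y \<in> I. y \<le> x}"

text \<open>Defined by recursion on a fuel argument (the size), which is always sufficient
  since recursive calls are on strictly smaller paths.\<close>
fun phi_aux :: "nat \<Rightarrow> int list \<Rightarrow> nat list \<Rightarrow> ltree" where
  "phi_aux 0 p \<sigma> = Leaf 0"
| "phi_aux (Suc f) p \<sigma> =
    (let n = length \<sigma> in
     if n = 2 then Node (Leaf 1) (Leaf 2)
     else if hd p = 0 then
       (let I = {1..n} - {hd \<sigma>} in
        Node (Leaf (hd \<sigma>)) (relabel (lam I) (phi_aux f (tl p) (map (lam_inv I) (tl \<sigma>)))))
     else
       (let k = (LEAST k. 1 \<le> k \<and> sum_list (take k p) = 0);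
            I1 = set (take k \<sigma>); I2 = set (drop k \<sigma>);
            p1 = map uminus (rev (take (k - 1) p)); p2 = drop k p;
            \<sigma>1 = map (lam_inv I1) (rev (take k \<sigma>)); \<sigma>2 = map (lam_inv I2) (drop k \<sigma>)
        in Node (relabel (lam I1) (phi_aux f p1 \<sigma>1)) (relabel (lam I2) (phi_aux f p2 \<sigma>2))))"

definition Phi :: "int list \<times> nat list \<Rightarrow> ltree" where
  "Phi x = phi_aux (length (snd x)) (fst x) (snd x)"

fun phi'_aux :: "nat \<Rightarrow> int list \<Rightarrow> nat list \<Rightarrow> ltree \<times> bool list" where
  "phi'_aux 0 p \<sigma> = (Leaf 0, [])"
| "phi'_aux (Suc f) p \<sigma> =
    (let n = length \<sigma> in
     if n = 1 then (Leaf 1, [])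
     else if hd p = 0 then
       (let I = {1..n} - {hd \<sigma>};
            r = phi'_aux f (tl p) (map (lam_inv I) (tl \<sigma>)) in
        (Node (Leaf (hd \<sigma>)) (relabel (lam I) (fst r)), True # snd r))
     else
       (let k = (GREATEST k. k \<le> n \<and>
                   (\<forall>j \<in> {2..k-1}. sum_list (take (j - 1) p) \<ge> 1) \<and>
                   sum_list (take (k - 1) p) = 1);
            I1 = set (take k \<sigma>); I2 = set (drop k \<sigma>);
            p1 = map uminus (rev (take (k - 1) p)); p2 = drop k p;
            \<sigma>1 = map (lam_inv I1) (rev (take k \<sigma>)); \<sigma>2 = map (lam_inv I2) (drop k \<sigma>)
        in if k = n then (phi_aux (length \<sigma>1) p1 \<sigma>1, [])
           else (let r = phi'_aux f p2 \<sigma>2 in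
                 (Node (relabel (lam I1) (phi_aux (length \<sigma>1) p1 \<sigma>1)) (relabel (lam I2) (fst r)),
                  True # snd r))))"

definition Phi' :: "int list \<times> nat list \<Rightarrow> ltree \<times> bool list" where
  "Phi' x = phi'_aux (length (snd x)) (fst x) (snd x)"

definition init_lab :: "ltree \<Rightarrow> bool list \<Rightarrow> nat option" where
  "init_lab t q = (if q \<in> positions t then
                     (case subtree_at t q of Leaf a \<Rightarrow> Some a | Node _ _ \<Rightarrow> None)
                   else None)"

definition lab_step :: "ltree \<Rightarrow> (bool list \<Rightarrow> nat option) \<Rightarrow> (bool list \<Rightarrow> nat option)" where
  "lab_step t lab =
    (let n = nleaves t;
         E = {q \<in> positions t. q \<noteq> [] \<and> lab q = None \<and>
                lab (q @ [False]) \<noteq> None \<and> lab (q @ [True]) \<noteq> None}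
     in if E = {} then lab
        else (let q0 = arg_min_on (\<lambda>q. min (the (lab (q @ [False]))) (the (lab (q @ [True])))) E;
                  v = (LEAST x. n < x \<and> x \<le> 2 * n - 2 \<and> (\<forall>q. lab q \<noteq> Some x))
              in lab(q0 := Some v)))"

text \<open>The full labelling: iterate until no step applies (card of positions steps suffice).\<close>
definition full_lab :: "ltree \<Rightarrow> bool list \<Rightarrow> nat option" where
  "full_lab t = (lab_step t ^^ card (positions t)) (init_lab t)"

definition Psi :: "ltree \<Rightarrow> nat \<Rightarrow> nat" where
  "Psi t i =
    (if \<exists>q. q \<in> positions t \<and> q \<noteq> [] \<and> full_lab t q = Some i
     then the (full_lab t (sibling (THE q. q \<in> positions t \<and> q \<noteq> [] \<and> full_lab t q = Some i)))
     else i)"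

definition Psi' :: "ltree \<times> bool list \<Rightarrow> nat \<Rightarrow> nat" where
  "Psi' tm i =
    (let t = fst tm; m = snd tm; n = nleaves t in
     if m = [] then
       (if i = 2 * n - 1 then 2 * n else if i = 2 * n then 2 * n - 1 else Psi t i)
     else
       (let k = the (full_lab t m); l = the (full_lab t (sibling m)) in
        if i = k then 2 * n else if i = l then 2 * n - 1
        else if i = 2 * n then k else if i = 2 * n - 1 then l
        else Psi t i))"

end

theory Submission
  imports Defs
begin

text \<open>Both compositions pass through unordered trees, that is, trees up to \<open>sim\<close>.

On the path side, a Motzkin path starting with an up step is cut at its first return to level 0,
a positive path at the end of its longest initial excursion above level 1 that ends at level 1.
The first piece is a reversed Motzkin path, and the sign of the step at the cut is dictated by the
two labels around it. So two subtrees can be glued back in exactly one way: for Motzkin paths the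
order of the two children is forced by the requirement that this step goes down, and for positive
paths by the position of the mark.

On the matching side, \<open>Psi t = \<pi>\<close> holds iff \<open>t\<close> is the tree in which the children of the vertex
labelled \<open>v\<close> are the pair of \<open>\<pi>\<close> that, among the pairs inside \<open>{1..<v}\<close> not yet used by smaller
vertices, has the least minimum; a count shows that such a pair always exists. For marked trees,
the label \<open>k\<close> of the marked vertex is read off as \<open>\<pi>' (2 * n)\<close>.\<close>

section \<open>Unordered trees\<close>

text \<open>\<open>Phi\<close> and \<open>Phi'\<close> standardise labels at every recursive call,
  and inductions through \<open>lam\<close> and \<open>lam_inv\<close> would hide the geometry. Both
  are therefore replaced by relations on arbitrary distinct labels; as these only compare labels,
  standardising commutes with them. Reversing the first piece puts the label next to the cut at its
  head, so gluing compares \<open>hd s\<close> with \<open>hd s'\<close>.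

  Trees are compared only up to exchanging children, so a position has no meaning across two trees.
  A marked vertex is identified by the set of leaf labels below it, which determines the vertex when
  leaves are distinct.

  \<open>Psi\<close> is an iterative procedure whose intermediate states are awkward to compare. It
  enters only through its final labelling, which is described by properties that have a unique
  solution. Expressed in terms of \<pi> alone, they constrain a function from vertex labels to pairs
  of \<pi>; this function is unique too, so it does not matter whether it is read off from a tree or
  computed from the matching.\<close>

fun leaf_labels :: "ltree \<Rightarrow> nat set" where
  "leaf_labels (Leaf a) = {a}"
| "leaf_labels (Node l r) = leaf_labels l \<union> leaf_labels r"

fun distinct_leaves :: "ltree \<Rightarrow> bool" where
  "distinct_leaves (Leaf a) \<longleftrightarrow> True"
| "distinct_leaves (Node l r) \<longleftrightarrow>
     distinct_leaves l \<and> distinct_leaves r \<and> leaf_labels l \<inter> leaf_labels r = {}"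

inductive sim :: "ltree \<Rightarrow> ltree \<Rightarrow> bool" where
  sim_Leaf: "sim (Leaf a) (Leaf a)"
| sim_Node: "sim l l' \<Longrightarrow> sim r r' \<Longrightarrow> sim (Node l r) (Node l' r')"
| sim_swap: "sim l l' \<Longrightarrow> sim r r' \<Longrightarrow> sim (Node l r) (Node r' l')"

inductive_cases sim_LeafE: "sim (Leaf a) t"
inductive_cases sim_NodeE: "sim (Node l r) t"

lemma leaf_labels_nonempty [simp]: "leaf_labels t \<noteq> {}"
  by (induction t) auto

lemma finite_leaf_labels [simp]: "finite (leaf_labels t)"
  by (induction t) auto

lemma relabel_relabel: "relabel g (relabel h t) = relabel (g \<circ> h) t"
  by (induction t) auto

lemma relabel_id_on: "(\<And>a. a \<in> leaf_labels t \<Longrightarrow> g a = a) \<Longrightarrow> relabel g t = t"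
  by (induction t) auto

lemma sim_sym: "sim t t' \<Longrightarrow> sim t' t"
  by (induction rule: sim.induct) (auto intro: sim.intros)

lemma leaf_labels_sim: "sim t t' \<Longrightarrow> leaf_labels t = leaf_labels t'"
  by (induction rule: sim.induct) auto

lemma distinct_leaves_sim: "sim t t' \<Longrightarrow> distinct_leaves t = distinct_leaves t'"
  by (induction rule: sim.induct) (auto simp: leaf_labels_sim Int_commute)

section \<open>Labelled paths\<close>

definition step_ok :: "int \<Rightarrow> nat \<Rightarrow> nat \<Rightarrow> bool" where
  "step_ok x a b \<longleftrightarrow> x \<in> {-1, 0, 1} \<and> (x = -1 \<longrightarrow> a < b) \<and> (x = 1 \<longrightarrow> b < a)"

fun labelled_path :: "int list \<Rightarrow> nat list \<Rightarrow> bool" where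
  "labelled_path [] [a] \<longleftrightarrow> True"
| "labelled_path (x # p) (a # b # s) \<longleftrightarrow> step_ok x a b \<and> labelled_path p (b # s)"
| "labelled_path _ _ \<longleftrightarrow> False"

definition rev_path :: "int list \<Rightarrow> int list" where
  "rev_path p = map uminus (rev p)"

text \<open>The strict bound on \<open>j\<close> leaves only the full path below 0; the label set is
  left free so that the pieces of a cut path need no renaming.\<close>

definition motzkin :: "int list \<Rightarrow> nat list \<Rightarrow> bool" where
  "motzkin p s \<longleftrightarrow> labelled_path p s \<and> distinct s \<and>
     (\<forall>j<length p. 0 \<le> sum_list (take j p)) \<and> sum_list p = -1"

definition positive :: "int list \<Rightarrow> nat list \<Rightarrow> bool" where
  "positive p s \<longleftrightarrow> labelled_path p s \<and> distinct s \<and> (\<forall>j\<le>length p. 0 \<le> sum_list (take j p))"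

lemma labelled_path_length: "labelled_path p s \<Longrightarrow> length s = Suc (length p)"
  by (induction p s rule: labelled_path.induct) auto

lemma labelled_path_Cons:
  "labelled_path (x # p) (a # s) \<longleftrightarrow> s \<noteq> [] \<and> step_ok x a (hd s) \<and> labelled_path p s"
  by (cases s) auto

lemma labelled_path_append:
  assumes "length s1 = Suc (length p1)"
  shows "labelled_path (p1 @ x # p2) (s1 @ s2) \<longleftrightarrow>
    labelled_path p1 s1 \<and> s2 \<noteq> [] \<and> step_ok x (last s1) (hd s2) \<and> labelled_path p2 s2"
  using assms
proof (induction p1 s1 rule: list_induct2')
  case (4 y p a s)
  then show ?case
    by (cases p; cases s) (auto simp: labelled_path_Cons)
qed (auto simp: labelled_path_Cons)

lemma labelled_path_iff:
  "labelled_path p s \<longleftrightarrow> length s = Suc (length p) \<and> set p \<subseteq> {-1, 0, 1} \<and>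
     (\<forall>i<length p. (p ! i = -1 \<longrightarrow> s ! i < s ! Suc i) \<and> (p ! i = 1 \<longrightarrow> s ! Suc i < s ! i))"
proof (induction p s rule: labelled_path.induct)
  case (2 x p a b s)
  show ?case
    by (simp only: labelled_path.simps(2) "2.IH") (auto simp: step_ok_def All_less_Suc2)
qed auto

lemma length_rev_path [simp]: "length (rev_path p) = length p"
  by (simp add: rev_path_def)

lemma rev_path_rev_path [simp]: "rev_path (rev_path p) = p"
  by (simp add: rev_path_def rev_map comp_def)

text \<open>Read backwards, an ascent becomes a descent, and negating the steps changes their signs
  accordingly.\<close>

lemma labelled_path_rev1: "labelled_path p s \<Longrightarrow> labelled_path (rev_path p) (rev s)"
proof (induction p s rule: labelled_path.induct)
  case (2 x p a b s)
  then have IH: "labelled_path (rev_path p) (rev (b # s))" by simp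
  then have "length (rev (b # s)) = Suc (length (rev_path p))" by (rule labelled_path_length)
  from labelled_path_append[OF this, of "- x" "[]" "[a]"] IH 2(2)
  show ?case by (auto simp: rev_path_def step_ok_def)
qed (auto simp: rev_path_def)

lemma labelled_path_rev [simp]: "labelled_path (rev_path p) (rev s) \<longleftrightarrow> labelled_path p s"
  by (metis labelled_path_rev1 rev_path_rev_path rev_rev_ident)

lemma sum_list_uminus: "sum_list (map uminus p) = - sum_list (p :: int list)"
  by (induction p) auto

lemma sum_list_rev_path [simp]: "sum_list (rev_path p) = - sum_list p"
  by (simp add: rev_path_def sum_list_uminus)

text \<open>A prefix of the reversed path is minus a suffix of the path, hence the complementary
  prefix sum minus the total.\<close>

lemma sum_list_take_rev_path:
  "sum_list (take j (rev_path p)) = sum_list (take (length p - j) p) - sum_list p"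
proof -
  have "sum_list p = sum_list (take (length p - j) p) + sum_list (drop (length p - j) p)"
    by (metis append_take_drop_id sum_list_append)
  moreover have "sum_list (take j (rev_path p)) = - sum_list (drop (length p - j) p)"
    by (simp add: rev_path_def take_map take_rev sum_list_uminus)
  ultimately show ?thesis by simp
qed

text \<open>Backwards, height \<open>h\<close> of a path ending at -1 becomes \<open>h + 1\<close>:
  the path turns into an excursion from 0 to 1 that stays at 1 or above after its start. In this
  shape Motzkin pieces sit at the front of longer paths.\<close>

lemma motzkin_rev_iff:
  "motzkin p s \<longleftrightarrow> labelled_path (rev_path p) (rev s) \<and> distinct s \<and>
     (\<forall>j\<in>{1..length p}. 1 \<le> sum_list (take j (rev_path p))) \<and> sum_list (rev_path p) = 1"
proof -
  have "(\<forall>j<length p. 0 \<le> sum_list (take j p)) \<longleftrightarrow>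
        (\<forall>j\<in>{1..length p}. 1 \<le> sum_list (take j (rev_path p)))" if "sum_list p = -1"
  proof safe
    fix j assume "\<forall>j<length p. 0 \<le> sum_list (take j p)" "j \<in> {1..length p}"
    then show "1 \<le> sum_list (take j (rev_path p))"
      using that by (auto simp: sum_list_take_rev_path)
  next
    fix j assume *: "\<forall>j\<in>{1..length p}. 1 \<le> sum_list (take j (rev_path p))" "j < length p"
    then have "1 \<le> sum_list (take (length p - j) (rev_path p))" by simp
    then show "0 \<le> sum_list (take j p)"
      using that * by (simp add: sum_list_take_rev_path)
  qed
  then show ?thesis unfolding motzkin_def by auto
qed

lemma sum_take_append_Cons:
  fixes p :: "int list"
  shows "sum_list (take j (p @ x # q)) =
    (if j \<le> length p then sum_list (take j p)
     else sum_list p + x + sum_list (take (j - Suc (length p)) q))"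
proof (cases "j \<le> length p")
  case False
  then obtain i where "j = Suc (length p) + i" by (metis le_add_diff_inverse not_less_eq_eq)
  then show ?thesis by simp
qed simp

section \<open>From paths to trees\<close>

text \<open>The graphs of the maps in the paper, freed from standardisation: labels range over
  arbitrary distinct numbers and subpaths are not renormalised.\<close>
inductive phi_graph :: "int list \<Rightarrow> nat list \<Rightarrow> ltree \<Rightarrow> bool" where
  phi_graph_base: "a < b \<Longrightarrow> phi_graph [-1] [a, b] (Node (Leaf a) (Leaf b))"
| phi_graph_flat: "phi_graph p s t \<Longrightarrow> a \<notin> set s \<Longrightarrow> phi_graph (0 # p) (a # s) (Node (Leaf a) t)"
| phi_graph_up: "phi_graph p s t \<Longrightarrow> phi_graph p' s' t' \<Longrightarrow> set s \<inter> set s' = {} \<Longrightarrow> hd s < hd s' \<Longrightarrow>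
    phi_graph (rev_path p @ -1 # p') (rev s @ s') (Node t t')"

inductive phi'_graph :: "int list \<Rightarrow> nat list \<Rightarrow> ltree \<Rightarrow> bool list \<Rightarrow> bool" where
  phi'_graph_base: "phi'_graph [] [a] (Leaf a) []"
| phi'_graph_flat: "phi'_graph p s t m \<Longrightarrow> a \<notin> set s \<Longrightarrow>
    phi'_graph (0 # p) (a # s) (Node (Leaf a) t) (True # m)"
| phi'_graph_root: "phi_graph p s t \<Longrightarrow> phi'_graph (rev_path p) (rev s) t []"
| phi'_graph_up: "phi_graph p s t \<Longrightarrow> phi'_graph p' s' t' m \<Longrightarrow> set s \<inter> set s' = {} \<Longrightarrow>
    phi'_graph (rev_path p @ (if hd s < hd s' then -1 else 1) # p') (rev s @ s') (Node t t') (True # m)"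

lemma phi_graph_motzkin:
  "phi_graph p s t \<Longrightarrow> motzkin p s \<and> leaf_labels t = set s \<and> distinct_leaves t"
proof (induction rule: phi_graph.induct)
  case (phi_graph_base a b)
  then show ?case by (auto simp: motzkin_def step_ok_def less_Suc_eq)
next
  case (phi_graph_flat p s t a)
  moreover from phi_graph_flat have "s \<noteq> []" unfolding motzkin_def
    by (metis labelled_path_length list.size(3) nat.distinct(1))
  ultimately show ?case
    by (auto simp: motzkin_def labelled_path_Cons step_ok_def All_less_Suc2)
next
  case (phi_graph_up p s t p' s' t')
  then have m: "motzkin p s" "motzkin p' s'" by auto
  then have len: "length s = Suc (length p)" "length s' = Suc (length p')"
    by (auto simp: motzkin_def labelled_path_length)
  then have "s \<noteq> []" "s' \<noteq> []" by auto
  then have "labelled_path (rev_path p @ -1 # p') (rev s @ s')"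
    using m phi_graph_up.hyps len
    by (subst labelled_path_append) (auto simp: motzkin_def step_ok_def last_rev)
  moreover have "0 \<le> sum_list (take j (rev_path p @ -1 # p'))"
    if "j < length (rev_path p @ -1 # p')" for j
  \<comment> \<open>Past the cut the height is 1 - 1 plus a height of \<open>p'\<close>; up to the
    cut the reversed piece stays at 1 or above.\<close>
  proof (cases "j = 0 \<or> j > length p")
    case True
    with that m have "j = 0 \<or> 0 \<le> sum_list (take (j - Suc (length p)) p')"
      by (auto simp: motzkin_def)
    with True m show ?thesis
      unfolding sum_take_append_Cons by (auto simp: motzkin_def)
  next
    case False
    then have "1 \<le> sum_list (take j (rev_path p))"
      using m(1) unfolding motzkin_rev_iff by auto
    with False show ?thesis by (auto simp: sum_take_append_Cons)
  qed
  ultimately have "motzkin (rev_path p @ -1 # p') (rev s @ s')"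
    using m phi_graph_up.hyps unfolding motzkin_def by auto
  then show ?case using phi_graph_up by auto
qed

lemma motzkin_length: "motzkin p s \<Longrightarrow> length s = Suc (length p) \<and> 1 \<le> length p"
  unfolding motzkin_def by (cases p) (auto dest: labelled_path_length)

lemma positive_length: "positive p s \<Longrightarrow> length s = Suc (length p)"
  unfolding positive_def by (auto dest: labelled_path_length)

lemma motzkin_nonempty: "motzkin p s \<Longrightarrow> s \<noteq> []"
  using motzkin_length by force

lemma phi_graph_is_Node: "phi_graph p s t \<Longrightarrow> \<exists>l r. t = Node l r"
  by (induction rule: phi_graph.induct) auto

lemma phi'_graph_positive:
  "phi'_graph p s t m \<Longrightarrow> positive p s \<and> leaf_labels t = set s \<and> distinct_leaves t \<and> m \<in> positions t"
proof (induction rule: phi'_graph.induct)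
  case (phi'_graph_base a)
  then show ?case by (auto simp: positive_def)
next
  case (phi'_graph_flat p s t m a)
  then have "s \<noteq> []" using positive_length by force
  with phi'_graph_flat show ?case
    by (auto simp: positive_def labelled_path_Cons step_ok_def take_Cons split: nat.splits)
next
  case (phi'_graph_root p s t)
  then have *: "motzkin p s" "leaf_labels t = set s" "distinct_leaves t" "[] \<in> positions t"
    using phi_graph_motzkin by (auto, cases t) auto
  have "0 \<le> sum_list (take j (rev_path p))" if "j \<le> length p" for j
  proof (cases "j = 0")
    case False
    with that have "1 \<le> sum_list (take j (rev_path p))"
      using *(1) unfolding motzkin_rev_iff by auto
    then show ?thesis by simp
  qed simp
  with * show ?case by (auto simp: positive_def motzkin_def)
next
  case (phi'_graph_up p s t p' s' t' m)
  let ?x = "if hd s < hd s' then -1 else 1 :: int"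
  have m: "motzkin p s" "positive p' s'" using phi'_graph_up phi_graph_motzkin by auto
  then have len: "length s = Suc (length p)" "length s' = Suc (length p')"
    by (auto simp: motzkin_length positive_length)
  then have ne: "s \<noteq> []" "s' \<noteq> []" by auto
  then have "hd s \<noteq> hd s'" using phi'_graph_up.hyps by (metis disjoint_iff hd_in_set)
  with ne have "labelled_path (rev_path p @ ?x # p') (rev s @ s')"
    using m phi'_graph_up.hyps len
    by (subst labelled_path_append) (auto simp: motzkin_def positive_def step_ok_def last_rev)
  moreover have "0 \<le> sum_list (take j (rev_path p @ ?x # p'))"
    if "j \<le> length (rev_path p @ ?x # p')" for j
  \<comment> \<open>The piece before the cut ends at 1 and the next step is -1 or 1, so the heights
    of \<open>p'\<close> are counted from 0 or from 2.\<close>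
  proof (cases "j = 0 \<or> j > length p")
    case True
    with that m have "j = 0 \<or> 0 \<le> sum_list (take (j - Suc (length p)) p')"
      by (auto simp: positive_def)
    with True m show ?thesis
      unfolding sum_take_append_Cons by (auto simp: motzkin_def)
  next
    case False
    then have "1 \<le> sum_list (take j (rev_path p))"
      using m(1) unfolding motzkin_rev_iff by auto
    with False show ?thesis by (auto simp: sum_take_append_Cons)
  qed
  ultimately have "positive (rev_path p @ ?x # p') (rev s @ s')"
    using m phi'_graph_up.hyps unfolding positive_def motzkin_def by auto
  then show ?case using phi'_graph_up phi_graph_motzkin by auto
qed

section \<open>Cutting paths into pieces\<close>

lemma labelled_path_split:
  assumes "labelled_path p s" "e < length p"
  shows "labelled_path (take e p) (take (Suc e) s)" "drop (Suc e) s \<noteq> []"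
    "step_ok (p ! e) (last (take (Suc e) s)) (hd (drop (Suc e) s))"
    "labelled_path (drop (Suc e) p) (drop (Suc e) s)"
proof -
  have len: "length s = Suc (length p)" using assms(1) by (rule labelled_path_length)
  have "labelled_path (take e p @ p ! e # drop (Suc e) p) (take (Suc e) s @ drop (Suc e) s)"
    using assms by (simp flip: id_take_nth_drop)
  then show "labelled_path (take e p) (take (Suc e) s)" "drop (Suc e) s \<noteq> []"
    "step_ok (p ! e) (last (take (Suc e) s)) (hd (drop (Suc e) s))"
    "labelled_path (drop (Suc e) p) (drop (Suc e) s)"
    by (subst (asm) labelled_path_append; use assms len in auto)+
qed

lemma motzkin_of_rev:
  assumes "labelled_path q r" "distinct r" "\<And>j. 1 \<le> j \<Longrightarrow> j \<le> length q \<Longrightarrow> 1 \<le> sum_list (take j q)"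
    "sum_list q = 1"
  shows "motzkin (rev_path q) (rev r)"
  unfolding motzkin_rev_iff using assms by simp

lemma sum_take_Suc:
  "j < length p \<Longrightarrow> sum_list (take (Suc j) p) = sum_list (take j p) + (p ! j :: int)"
  by (simp add: take_Suc_conv_app_nth)

lemma sum_take_drop:
  "sum_list (take j (drop k p)) = sum_list (take (k + j) p) - sum_list (take k (p :: int list))"
  by (simp add: take_add)

lemma labelled_path_steps: "labelled_path p s \<Longrightarrow> i < length p \<Longrightarrow> p ! i \<in> {-1, 0, 1}"
  unfolding labelled_path_iff using nth_mem by blast

lemma motzkin_first_return:
  assumes "motzkin p s" "hd p = 1"
  obtains p1 s1 p2 s2 where "p = rev_path p1 @ -1 # p2" "s = rev s1 @ s2"
    "motzkin p1 s1" "motzkin p2 s2" "set s1 \<inter> set s2 = {}" "hd s1 < hd s2"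
proof -
  define S where "S j = sum_list (take j p)" for j
  define N where "N = length p"
  have lp: "labelled_path p s" and ds: "distinct s" and S_nonneg: "\<And>j. j < N \<Longrightarrow> 0 \<le> S j"
    and SN: "S N = -1"
    using assms(1) by (auto simp: motzkin_def S_def N_def)
  have steps: "p ! j \<in> {-1, 0, 1}" if "j < N" for j
    using labelled_path_steps lp that unfolding N_def by blast
  have S_Suc: "S (Suc j) = S j + p ! j" if "j < N" for j
    using that by (simp add: S_def N_def sum_take_Suc)
  have N1: "1 \<le> N" using motzkin_length[OF assms(1)] by (simp add: N_def)
  have S1: "S 1 = 1"
    using assms(2) N1 by (cases p) (auto simp: S_def N_def)
  have N2: "2 \<le> N" using N1 SN S1 by (cases "N = 1") auto
  \<comment> \<open>Only the last step reaches -1, so it starts at height 0; level 0 is thus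
    revisited before the end.\<close>
  then have "S (N - 1) = 0"
    using S_nonneg[of "N - 1"] S_Suc[of "N - 1"] steps[of "N - 1"] SN by auto
  then have ex: "1 \<le> N - 1 \<and> S (N - 1) = 0" using N2 by auto
  define k where "k = (LEAST k. 1 \<le> k \<and> S k = 0)"
  have k: "1 \<le> k" "S k = 0" using LeastI[of "\<lambda>k. 1 \<le> k \<and> S k = 0", OF ex] by (auto simp: k_def)
  have k_le: "k \<le> N - 1" unfolding k_def by (rule Least_le) (rule ex)
  have S_pos: "1 \<le> S j" if "1 \<le> j" "j < k" for j
    using not_less_Least[of j "\<lambda>k. 1 \<le> k \<and> S k = 0"] that S_nonneg[of j] k_le N2
    by (fastforce simp: k_def)
  obtain e where e: "k = Suc e" using k by (cases k) auto
  have e1: "1 \<le> e" using k S1 e by (cases e) auto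
  have eN: "e < N" using e k_le N2 by auto
  \<comment> \<open>At times strictly between 0 and \<open>k\<close> the height is at least 1, and a
    step changes it by at most 1, so level 0 is entered from 1 by a down step.\<close>
  have Se: "S e = 1 \<and> p ! e = -1"
    using S_Suc[OF eN] steps[OF eN] S_pos[of e] k e e1 by auto
  note split = labelled_path_split[OF lp eN[unfolded N_def]]
  have "motzkin (rev_path (take e p)) (rev (take (Suc e) s))"
  proof (rule motzkin_of_rev)
    fix j assume "1 \<le> j" "j \<le> length (take e p)"
    then show "1 \<le> sum_list (take j (take e p))"
      using S_pos[of j] e by (simp add: S_def min_absorb1)
  qed (use split ds Se in \<open>auto simp: S_def\<close>)
  moreover have "motzkin (drop (Suc e) p) (drop (Suc e) s)"
    unfolding motzkin_def
  proof (intro conjI allI impI)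
    fix j assume "j < length (drop (Suc e) p)"
    then show "0 \<le> sum_list (take j (drop (Suc e) p))"
      using S_nonneg[of "Suc e + j"] k e unfolding sum_take_drop by (auto simp: S_def N_def)
  next
    have "sum_list p = sum_list (take (Suc e) p) + sum_list (drop (Suc e) p)"
      by (metis append_take_drop_id sum_list_append)
    then show "sum_list (drop (Suc e) p) = -1"
      using k e SN by (simp add: S_def N_def)
  qed (use split ds in auto)
  moreover have "p = rev_path (rev_path (take e p)) @ -1 # drop (Suc e) p"
    unfolding rev_path_rev_path using id_take_nth_drop[OF eN[unfolded N_def]] Se by metis
  moreover have "set (rev (take (Suc e) s)) \<inter> set (drop (Suc e) s) = {}"
    using ds set_take_disj_set_drop_if_distinct[of s "Suc e" "Suc e"] by simp
  moreover have "hd (rev (take (Suc e) s)) < hd (drop (Suc e) s)"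
    using split(3) Se by (simp add: step_ok_def hd_rev)
  moreover have "s = rev (rev (take (Suc e) s)) @ drop (Suc e) s" by simp
  ultimately show thesis using that by blast
qed

lemma positive_last_one:
  assumes "positive p s" "hd p = 1" "p \<noteq> []"
  obtains (whole) p1 s1 where "p = rev_path p1" "s = rev s1" "motzkin p1 s1"
  | (split) p1 s1 p2 s2 where "p = rev_path p1 @ (if hd s1 < hd s2 then -1 else 1) # p2"
    "s = rev s1 @ s2" "motzkin p1 s1" "positive p2 s2" "set s1 \<inter> set s2 = {}"
proof -
  define S where "S j = sum_list (take j p)" for j
  define N where "N = length p"
  have lp: "labelled_path p s" and ds: "distinct s" and S_nonneg: "\<And>j. j \<le> N \<Longrightarrow> 0 \<le> S j"
    using assms(1) by (auto simp: positive_def S_def N_def)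
  have steps: "p ! j \<in> {-1, 0, 1}" if "j < N" for j
    using labelled_path_steps lp that unfolding N_def by blast
  have S_Suc: "S (Suc j) = S j + p ! j" if "j < N" for j
    using that by (simp add: S_def N_def sum_take_Suc)
  have N1: "1 \<le> N" using assms(3) by (cases p) (auto simp: N_def)
  have S1: "S 1 = 1"
    using assms(2) N1 by (cases p) (auto simp: S_def N_def)
  \<comment> \<open>\<open>e\<close> counts steps where the recursion of \<open>Phi'\<close> counts
    labels: the \<open>k\<close> used there is \<open>Suc e\<close> for the greatest such
    \<open>e\<close>.\<close>
  define Q where "Q e \<longleftrightarrow> 1 \<le> e \<and> e \<le> N \<and> (\<forall>j\<in>{1..e}. 1 \<le> S j) \<and> S e = 1" for e
  have "Q 1" using N1 S1 by (auto simp: Q_def)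
  then obtain e where e: "Q e" and max: "\<And>e'. Q e' \<Longrightarrow> e' \<le> e"
    using Greatest_le_nat[of Q _ N] GreatestI_nat[of Q 1 N] Q_def by blast
  have motz: "motzkin (rev_path (take e p)) (rev (take (Suc e) s))"
    if "labelled_path (take e p) (take (Suc e) s)"
  proof (rule motzkin_of_rev)
    fix j assume "1 \<le> j" "j \<le> length (take e p)"
    then show "1 \<le> sum_list (take j (take e p))"
      using e by (simp add: Q_def S_def min_absorb1)
  qed (use that ds e in \<open>auto simp: S_def Q_def\<close>)
  show thesis
  proof (cases "e = N")
    case True
    then have "take e p = p" "take (Suc e) s = s"
      using labelled_path_length[OF lp] by (auto simp: N_def)
    with motz lp show thesis by (intro whole[of "rev_path p" "rev s"]) auto
  next
    case False
    then have eN: "e < N" using e by (auto simp: Q_def)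
    note split' = labelled_path_split[OF lp eN[unfolded N_def]]
    \<comment> \<open>A flat step at the cut would prolong the initial piece.\<close>
    have nonzero: "p ! e \<noteq> 0"
    proof
      assume "p ! e = 0"
      then have "Q (Suc e)" using e eN S_Suc[OF eN] by (auto simp: Q_def le_Suc_eq)
      then show False using max by fastforce
    qed
    \<comment> \<open>Positivity of the second piece needs the height right after the cut as a lower
      bound for all later heights. After a down step this height is 0. After an up step it is 2, and
      the first later drop below 2 would land on 1 and give a larger \<open>e\<close>.\<close>
    have later: "S (Suc e) \<le> S j" if "Suc e \<le> j" "j \<le> N" for j
    proof (cases "p ! e = 1")
      case False
      then have "S (Suc e) = 0" using nonzero steps[OF eN] S_Suc[OF eN] e by (auto simp: Q_def)
      then show ?thesis using S_nonneg that by auto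
    next
      case True
      then have S2: "S (Suc e) = 2" using S_Suc[OF eN] e by (auto simp: Q_def)
      from that show ?thesis
      proof (induction j rule: nat_less_induct)
        case (1 j)
        show ?case
        proof (rule ccontr)
          assume less: "\<not> ?case"
          then have "j \<noteq> Suc e" by auto
          then obtain i where i: "j = Suc i" "Suc e \<le> i" using 1 by (cases j) auto
          then have prev: "2 \<le> S j'" if "Suc e \<le> j'" "j' \<le> i" for j' using 1 S2 that by auto
          have "S j = 1"
            using prev[of i] S_Suc[of i] steps[of i] i less S2 "1.prems" by auto
          moreover have "1 \<le> S j'" if "j' \<in> {1..j}" for j'
          proof (cases "j' \<le> e")
            case True
            then show ?thesis using e that by (auto simp: Q_def)
          next
            case False
            then show ?thesis using prev[of j'] that i \<open>S j = 1\<close> by (cases "j' = j") auto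
          qed
          ultimately have "Q j" using "1.prems" by (auto simp: Q_def)
          then show False using max "1.prems" by fastforce
        qed
      qed
    qed
    \<comment> \<open>The sign of a nonzero step is dictated by the comparison of its two labels, so
      it need not be remembered by the tree.\<close>
    have pe: "p ! e = (if hd (rev (take (Suc e) s)) < hd (drop (Suc e) s) then -1 else 1)"
      using nonzero split'(3) steps[OF eN] by (auto simp: step_ok_def hd_rev)
    show thesis
    proof (rule split[of "rev_path (take e p)" "rev (take (Suc e) s)" "drop (Suc e) s" "drop (Suc e) p"])
      show "p = rev_path (rev_path (take e p)) @
        (if hd (rev (take (Suc e) s)) < hd (drop (Suc e) s) then -1 else 1) # drop (Suc e) p"
        unfolding pe[symmetric] rev_path_rev_path by (rule id_take_nth_drop[OF eN[unfolded N_def]])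
      show "set (rev (take (Suc e) s)) \<inter> set (drop (Suc e) s) = {}"
        using ds set_take_disj_set_drop_if_distinct[of s "Suc e" "Suc e"] by simp
      show "positive (drop (Suc e) p) (drop (Suc e) s)"
        unfolding positive_def
      proof (intro conjI allI impI)
        fix j assume "j \<le> length (drop (Suc e) p)"
        then show "0 \<le> sum_list (take j (drop (Suc e) p))"
          using later[of "Suc e + j"] eN unfolding sum_take_drop by (auto simp: S_def N_def)
      qed (use split' ds in auto)
    qed (use motz split' in auto)
  qed
qed

lemma motzkin_imp_phi_graph: "motzkin p s \<Longrightarrow> \<exists>t. phi_graph p s t"
proof (induction "length p" arbitrary: p s rule: less_induct)
  case less
  have len: "length s = Suc (length p)" "1 \<le> length p" using motzkin_length[OF less.prems] by auto
  then obtain x q a b r where ps: "p = x # q" "s = a # b # r"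
    by (cases p; cases s; cases "tl s") auto
  have lp: "step_ok x a b" "labelled_path q (b # r)" and ds: "distinct s"
    using less.prems by (auto simp: ps motzkin_def)
  show ?case
  proof (cases "q = []")
    case True
    then have "x = -1" "r = []" using less.prems len ps by (auto simp: motzkin_def)
    then show ?thesis using lp ps True by (auto simp: step_ok_def intro: phi_graph_base)
  next
    case False
    then have "1 < length p" using ps by (cases q) auto
    \<comment> \<open>With more than one step, the first prefix is a proper one, so the first step
      does not go down.\<close>
    then have "0 \<le> sum_list (take 1 p)" using less.prems unfolding motzkin_def by blast
    then have "0 \<le> x" by (simp add: ps)
    then consider "x = 0" | "x = 1" using lp by (auto simp: step_ok_def)
    then show ?thesis
    proof cases
      case 1
      then have "motzkin q (b # r)"
        using less.prems lp ps by (auto simp: motzkin_def All_less_Suc2)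
      with less.hyps ps obtain t where "phi_graph q (b # r) t" by force
      then show ?thesis using 1 ps ds phi_graph_flat[of q "b # r" t a] by auto
    next
      case 2
      then have "hd p = 1" using ps by simp
      obtain p1 s1 p2 s2 where *: "p = rev_path p1 @ -1 # p2" "s = rev s1 @ s2"
          "motzkin p1 s1" "motzkin p2 s2" "set s1 \<inter> set s2 = {}" "hd s1 < hd s2"
        by (rule motzkin_first_return[OF less.prems \<open>hd p = 1\<close>])
      have "length p1 < length p" "length p2 < length p" unfolding *(1) by simp_all
      then obtain t1 t2 where "phi_graph p1 s1 t1" "phi_graph p2 s2 t2"
        using less.hyps *(3,4) by blast
      then show ?thesis unfolding *(1,2) using phi_graph_up[OF _ _ *(5,6)] by blast
    qed
  qed
qed

lemma positive_imp_phi'_graph: "positive p s \<Longrightarrow> \<exists>t m. phi'_graph p s t m"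
proof (induction "length p" arbitrary: p s rule: less_induct)
  case less
  have len: "length s = Suc (length p)" using positive_length[OF less.prems] .
  show ?case
  proof (cases p)
    case Nil
    then show ?thesis using len by (auto simp: length_Suc_conv intro: phi'_graph_base)
  next
    case (Cons x q)
    then obtain a b r where s: "s = a # b # r"
      using len by (metis length_Suc_conv)
    have lp: "step_ok x a b" "labelled_path q (b # r)" and ds: "distinct s"
      using less.prems by (auto simp: Cons s positive_def)
    have nonneg: "0 \<le> sum_list (take j p)" if "j \<le> length p" for j
      using less.prems that by (auto simp: positive_def)
    have "0 \<le> x" using nonneg[of 1] Cons by auto
    then consider "x = 0" | "x = 1" using lp by (auto simp: step_ok_def)
    then show ?thesis
    proof cases
      case 1
      have "0 \<le> sum_list (take j q)" if "j \<le> length q" for j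
        using nonneg[of "Suc j"] that 1 Cons by simp
      then have "positive q (b # r)"
        using lp ds s by (simp add: positive_def)
      with less.hyps Cons obtain t m where "phi'_graph q (b # r) t m" by force
      then show ?thesis using 1 Cons s ds phi'_graph_flat[of q "b # r" t m a] by auto
    next
      case 2
      then have "hd p = 1" "p \<noteq> []" using Cons by auto
      from less.prems this show ?thesis
      proof (cases rule: positive_last_one)
        case (whole p1 s1)
        then show ?thesis using motzkin_imp_phi_graph phi'_graph_root by blast
      next
        case (split p1 s1 p2 s2)
        obtain t1 where "phi_graph p1 s1 t1" using split motzkin_imp_phi_graph by blast
        moreover have "length p2 < length p" unfolding split(1) by simp
        then obtain t2 m2 where "phi'_graph p2 s2 t2 m2"
          using less.hyps split(4) by blast
        ultimately show ?thesis unfolding split(1,2) using phi'_graph_up[OF _ _ split(5)] by blast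
      qed
    qed
  qed
qed

section \<open>Standardisation of labels\<close>

lemma lam_inv_strict_mono:
  assumes "finite I"
  shows "strict_mono_on I (lam_inv I)"
  unfolding strict_mono_on_def lam_inv_def
proof (intro allI impI)
  fix r s assume *: "r \<in> I \<and> s \<in> I \<and> r < s"
  then have "{y \<in> I. y \<le> r} \<subset> {y \<in> I. y \<le> s}" by (auto dest!: equalityD2)
  then show "card {y \<in> I. y \<le> r} < card {y \<in> I. y \<le> s}" using assms by (simp add: psubset_card_mono)
qed

lemma lam_inv_image:
  assumes "finite I"
  shows "lam_inv I ` I = {1..card I}"
proof (rule card_subset_eq)
  show "lam_inv I ` I \<subseteq> {1..card I}"
    using assms by (auto simp: lam_inv_def Suc_le_eq card_gt_0_iff intro!: card_mono)
  show "card (lam_inv I ` I) = card {1..card I}"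
    using lam_inv_strict_mono[OF assms] by (simp add: card_image strict_mono_on_imp_inj_on)
qed simp

lemma lam_lam_inv:
  assumes "finite I" "x \<in> I"
  shows "lam I (lam_inv I x) = x"
proof -
  define xs where "xs = sorted_list_of_set I"
  have xs: "set xs = I" "sorted xs" "distinct xs" using assms by (auto simp: xs_def)
  then obtain i where i: "i < length xs" "x = xs ! i"
    using assms by (metis in_set_conv_nth)
  have mono: "xs ! j \<le> xs ! i \<longleftrightarrow> j \<le> i" if "j < length xs" for j
    using xs i that
    by (metis le_antisym linorder_le_cases nth_eq_iff_index_eq sorted_nth_mono)
  have "{y \<in> I. y \<le> x} = (!) xs ` {..i}"
  proof (intro equalityI subsetI)
    fix y assume "y \<in> {y \<in> I. y \<le> x}"
    then show "y \<in> (!) xs ` {..i}" using i mono by (auto simp: xs(1)[symmetric] in_set_conv_nth)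
  next
    fix y assume "y \<in> (!) xs ` {..i}"
    then obtain j where "j \<le> i" "y = xs ! j" by auto
    then show "y \<in> {y \<in> I. y \<le> x}" using i mono[of j] xs(1) nth_mem[of j xs] by auto
  qed
  \<comment> \<open>\<open>i\<close> counts from 0 and ranks count from 1; \<open>lam\<close>
    subtracts the difference again.\<close>
  then have "lam_inv I x = Suc i"
    using xs i by (simp add: lam_inv_def card_image inj_on_nth)
  then show ?thesis using i by (simp add: lam_def xs_def)
qed

text \<open>The rules inspect labels only through \<open><\<close> and distinctness, so a strictly
  increasing renaming carries derivations along. This absorbs the standardisation in each recursive
  call of \<open>Phi\<close>.\<close>

lemma phi_graph_map:
  "phi_graph p s t \<Longrightarrow> strict_mono_on (set s) g \<Longrightarrow> phi_graph p (map g s) (relabel g t)"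
proof (induction rule: phi_graph.induct)
  case (phi_graph_base a b)
  then show ?case by (auto simp: strict_mono_on_def intro: phi_graph.phi_graph_base)
next
  case (phi_graph_flat p s t a)
  have "inj_on g (set (a # s))" using phi_graph_flat.prems by (rule strict_mono_on_imp_inj_on)
  moreover have "strict_mono_on (set s) g"
    using phi_graph_flat.prems by (auto simp: strict_mono_on_def)
  ultimately show ?case using phi_graph_flat by (auto intro!: phi_graph.phi_graph_flat)
next
  case (phi_graph_up p s t p' s' t')
  have inj: "inj_on g (set (rev s @ s'))"
    using phi_graph_up.prems by (rule strict_mono_on_imp_inj_on)
  have mono: "strict_mono_on (set s) g" "strict_mono_on (set s') g"
    using phi_graph_up.prems by (auto simp: strict_mono_on_def)
  have ne: "s \<noteq> []" "s' \<noteq> []"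
    using phi_graph_up.hyps phi_graph_motzkin motzkin_nonempty by blast+
  then have "g (hd s) < g (hd s')"
    using phi_graph_up by (auto simp: strict_mono_on_def)
  moreover have "set (map g s) \<inter> set (map g s') = {}"
    using inj phi_graph_up.hyps by (fastforce simp: inj_on_def)
  ultimately show ?case
    using phi_graph.phi_graph_up[OF phi_graph_up.IH(1)[OF mono(1)] phi_graph_up.IH(2)[OF mono(2)]] ne
    by (simp add: rev_map hd_map)
qed

lemma phi'_graph_map:
  "phi'_graph p s t m \<Longrightarrow> strict_mono_on (set s) g \<Longrightarrow> phi'_graph p (map g s) (relabel g t) m"
proof (induction rule: phi'_graph.induct)
  case (phi'_graph_base a)
  then show ?case by (auto intro: phi'_graph.phi'_graph_base)
next
  case (phi'_graph_flat p s t m a)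
  have "inj_on g (set (a # s))" using phi'_graph_flat.prems by (rule strict_mono_on_imp_inj_on)
  moreover have "strict_mono_on (set s) g"
    using phi'_graph_flat.prems by (auto simp: strict_mono_on_def)
  ultimately show ?case using phi'_graph_flat by (auto intro!: phi'_graph.phi'_graph_flat)
next
  case (phi'_graph_root p s t)
  then show ?case using phi'_graph.phi'_graph_root[OF phi_graph_map] by (simp add: rev_map)
next
  case (phi'_graph_up p s t p' s' t' m)
  have inj: "inj_on g (set (rev s @ s'))"
    using phi'_graph_up.prems by (rule strict_mono_on_imp_inj_on)
  have mono: "strict_mono_on (set s) g" "strict_mono_on (set s') g"
    using phi'_graph_up.prems by (auto simp: strict_mono_on_def)
  have ne: "s \<noteq> []" "s' \<noteq> []"
    using phi'_graph_up.hyps phi_graph_motzkin motzkin_nonempty phi'_graph_positive positive_length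
    by force+
  then have "hd s \<in> set (rev s @ s')" "hd s' \<in> set (rev s @ s')" by auto
  then have hd_iff: "g (hd s) < g (hd s') \<longleftrightarrow> hd s < hd s'"
    using phi'_graph_up.prems unfolding strict_mono_on_def
    by (metis linorder_neqE_nat order_less_asym)
  moreover have "set (map g s) \<inter> set (map g s') = {}"
    using inj phi'_graph_up.hyps by (fastforce simp: inj_on_def)
  ultimately show ?case
    using phi'_graph.phi'_graph_up[OF phi_graph_map[OF phi'_graph_up.hyps(1) mono(1)] phi'_graph_up.IH[OF mono(2)]] ne
    by (simp add: rev_map hd_map)
qed

lemma standardise:
  assumes "distinct s"
  shows "set (map (lam_inv (set s)) s) = {1..length (map (lam_inv (set s)) s)}"
    "strict_mono_on (set s) (lam_inv (set s))"
    "leaf_labels t = set s \<Longrightarrow> relabel (lam (set s)) (relabel (lam_inv (set s)) t) = t"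
  using assms
  by (auto simp: lam_inv_image distinct_card relabel_relabel lam_lam_inv lam_inv_strict_mono
      intro!: relabel_id_on)

section \<open>Evaluating \<open>Phi\<close> and \<open>Phi'\<close> on glued paths\<close>

lemma rev_motzkin_hd:
  assumes "motzkin p s"
  shows "rev_path p \<noteq> []" "hd (rev_path p) = 1"
proof -
  have len: "1 \<le> length (rev_path p)" using motzkin_length[OF assms] by simp
  then show "rev_path p \<noteq> []" by (metis list.size(3) not_one_le_zero)
  then obtain x q where xq: "rev_path p = x # q" by (cases "rev_path p") auto
  have "1 \<le> sum_list (take 1 (rev_path p))"
    using assms len unfolding motzkin_rev_iff by simp
  moreover have "x \<in> {-1, 0, 1}"
    using assms xq unfolding motzkin_rev_iff labelled_path_iff by auto
  ultimately show "hd (rev_path p) = 1" using xq by auto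
qed

text \<open>The reversed first piece stays at 1 or above and ends at 1, so the down step after it is
  the first to reach 0. It is step number \<open>length p + 1\<close>, which is the number of labels
  in \<open>s\<close>.\<close>

lemma Least_first_return:
  assumes "motzkin p s"
  shows "(LEAST k. 1 \<le> k \<and> sum_list (take k (rev_path p @ -1 # p')) = 0) = length s"
proof (rule Least_equality)
  have "length s = Suc (length p)" using motzkin_length[OF assms] by simp
  then show "1 \<le> length s \<and> sum_list (take (length s) (rev_path p @ -1 # p')) = 0"
    using assms unfolding sum_take_append_Cons by (simp add: motzkin_def)
next
  fix k assume k: "1 \<le> k \<and> sum_list (take k (rev_path p @ -1 # p')) = 0"
  show "length s \<le> k"
  proof (rule ccontr)
    assume "\<not> length s \<le> k"
    then have kp: "k \<in> {1..length p}" using k motzkin_length[OF assms] by auto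
    then have "1 \<le> sum_list (take k (rev_path p))"
      using assms unfolding motzkin_rev_iff by blast
    then show False using k kp unfolding sum_take_append_Cons by simp
  qed
qed

text \<open>The condition on \<open>set s\<close> is what the code takes for granted: it returns the
  leaves 1 and 2 in the base case and forms \<open>{1..n} - {hd \<sigma>}\<close> in the flat case.
  The fuel suffices because all pieces are strictly shorter.\<close>

lemma phi_aux_eq:
  "phi_graph p s t \<Longrightarrow> set s = {1..length s} \<Longrightarrow> length s \<le> f \<Longrightarrow> phi_aux f p s = t"
proof (induction f arbitrary: p s t)
  case 0
  then show ?case using phi_graph_motzkin motzkin_nonempty by fastforce
next
  case (Suc f)
  \<comment> \<open>A recursive call standardises the piece and renames the resulting tree back; by
    \<open>phi_graph_map\<close> and \<open>standardise\<close> this detour has no effect.\<close>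
  have rec: "relabel (lam (set s')) (phi_aux f p' (map (lam_inv (set s')) s')) = t'"
    if "phi_graph p' s' t'" "length s' \<le> f" for p' s' t'
  proof -
    have *: "distinct s'" "leaf_labels t' = set s'"
      using phi_graph_motzkin[OF that(1)] by (auto simp: motzkin_def)
    have "phi_aux f p' (map (lam_inv (set s')) s') = relabel (lam_inv (set s')) t'"
      by (rule Suc.IH[OF phi_graph_map[OF that(1)]]) (use standardise[OF *(1)] that in auto)
    then show ?thesis using standardise(3)[OF *(1,2)] by simp
  qed
  from Suc.prems(1) show ?case
  proof cases
    case (phi_graph_base a b)
    then have "{a, b} = {1..2}" using Suc.prems by (simp add: numeral_2_eq_2)
    also have "{1..2::nat} = {1, 2}" by auto
    finally have "a = 1 \<and> b = 2" using phi_graph_base by (auto simp: doubleton_eq_iff)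
    then show ?thesis using phi_graph_base by simp
  next
    case (phi_graph_flat p' s' t' a)
    have "2 \<le> length s'" using phi_graph_motzkin[OF phi_graph_flat(4)] motzkin_length by fastforce
    moreover have "{1..length s} - {a} = set s'" using Suc.prems(2)[symmetric] phi_graph_flat
      by auto
    ultimately show ?thesis
      using rec[OF phi_graph_flat(4)] Suc.prems(3) phi_graph_flat by (simp add: Let_def)
  next
    case (phi_graph_up p1 s1 t1 p2 s2 t2)
    have m: "motzkin p1 s1" "motzkin p2 s2" using phi_graph_motzkin phi_graph_up by auto
    then have len: "length s1 = Suc (length p1)" "length s2 = Suc (length p2)" "1 \<le> length p1"
      using motzkin_length by auto
    define k where "k = (LEAST k. 1 \<le> k \<and> sum_list (take k p) = 0)"
    have k: "k = length s1" unfolding k_def phi_graph_up(1) by (rule Least_first_return[OF m(1)])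
    have "take k s = rev s1" "drop k s = s2" "take (k - 1) p = rev_path p1" "drop k p = p2"
      by (auto simp: k len phi_graph_up(1,2))
    moreover have "map uminus (rev (rev_path p1)) = p1"
      using rev_path_rev_path[of p1] by (simp add: rev_path_def)
    moreover have "hd p = 1" "length s \<noteq> 2"
      using rev_motzkin_hd[OF m(1)] len by (auto simp: phi_graph_up(1,2))
    moreover have "length s1 \<le> f" "length s2 \<le> f" using Suc.prems(3) len
      by (auto simp: phi_graph_up(2))
    ultimately show ?thesis
      using rec[OF phi_graph_up(4)] rec[OF phi_graph_up(5)]
      unfolding phi_aux.simps(2) Let_def k_def[symmetric] by (simp add: phi_graph_up(3))
  qed
qed

lemma Greatest_last_one:
  assumes "motzkin p s"
  shows "(GREATEST k. k \<le> length s \<and> (\<forall>j\<in>{2..k-1}. 1 \<le> sum_list (take (j - 1) (rev_path p))) \<and>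
      sum_list (take (k - 1) (rev_path p)) = 1) = length s"
proof (rule Greatest_equality)
  have "length s = Suc (length p)" using motzkin_length[OF assms] by simp
  then show "length s \<le> length s \<and>
    (\<forall>j\<in>{2..length s - 1}. 1 \<le> sum_list (take (j - 1) (rev_path p))) \<and>
    sum_list (take (length s - 1) (rev_path p)) = 1"
    using assms unfolding motzkin_rev_iff by fastforce
qed auto

lemma Greatest_last_one_append:
  assumes "motzkin p s" "positive p' s'" "x \<in> {-1, 1}"
  shows "(GREATEST k. k \<le> length (rev s @ s') \<and>
      (\<forall>j\<in>{2..k-1}. 1 \<le> sum_list (take (j - 1) (rev_path p @ x # p'))) \<and>
      sum_list (take (k - 1) (rev_path p @ x # p')) = 1) = length s"
proof (rule Greatest_equality)
  have len: "length s = Suc (length p)" using motzkin_length[OF assms(1)] by simp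
  have len': "length s' = Suc (length p')" using positive_length[OF assms(2)] by simp
  show "length s \<le> length (rev s @ s') \<and>
    (\<forall>j\<in>{2..length s - 1}. 1 \<le> sum_list (take (j - 1) (rev_path p @ x # p'))) \<and>
    sum_list (take (length s - 1) (rev_path p @ x # p')) = 1"
    using assms(1) len unfolding motzkin_rev_iff sum_take_append_Cons by auto
  fix k assume k: "k \<le> length (rev s @ s') \<and>
      (\<forall>j\<in>{2..k-1}. 1 \<le> sum_list (take (j - 1) (rev_path p @ x # p'))) \<and>
      sum_list (take (k - 1) (rev_path p @ x # p')) = 1"
  have sum: "sum_list (rev_path p) = 1" using assms(1) by (simp add: motzkin_def)
  show "k \<le> length s"
  proof (rule ccontr)
    assume gt: "\<not> k \<le> length s"
    have after: "sum_list (take (length s) (rev_path p @ x # p')) = 1 + x"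
      unfolding sum_take_append_Cons using len sum by simp
    show False
    proof (cases "x = 1")
      case True
      \<comment> \<open>From the up step onwards all heights are at least 2, so none of them can be
        the required final 1.\<close>
      have "sum_list (take (k - 1) (rev_path p @ x # p')) =
          2 + sum_list (take (k - 1 - length s) p')"
        unfolding sum_take_append_Cons using len sum gt True by simp
      moreover have "0 \<le> sum_list (take (k - 1 - length s) p')"
        using assms(2) k len' by (auto simp: positive_def)
      ultimately show False using k by linarith
    next
      case False
      \<comment> \<open>After a down step height 0 is met at time \<open>length s\<close>. This
        contradicts the final value 1 if \<open>k = Suc (length s)\<close>, and otherwise the lower
        bound at \<open>j = Suc (length s)\<close>.\<close>
      then have "sum_list (take (length s) (rev_path p @ x # p')) = 0" using after assms(3) by simp
      moreover have "1 \<le> sum_list (take (length s) (rev_path p @ x # p'))"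
      proof (cases "k = Suc (length s)")
        case True
        then show ?thesis using k by simp
      next
        case False
        then have "Suc (length s) \<in> {2..k-1}" using gt len by auto
        then show ?thesis using k by (metis diff_Suc_1)
      qed
      ultimately show False by simp
    qed
  qed
qed

lemma phi'_aux_eq:
  "phi'_graph p s t m \<Longrightarrow> set s = {1..length s} \<Longrightarrow> length s \<le> f \<Longrightarrow> phi'_aux f p s = (t, m)"
proof (induction f arbitrary: p s t m)
  case 0
  then show ?case using phi'_graph_positive positive_length by fastforce
next
  case (Suc f)
  have rec: "(relabel (lam (set s')) (fst (phi'_aux f p' (map (lam_inv (set s')) s'))),
      snd (phi'_aux f p' (map (lam_inv (set s')) s'))) = (t', m')"
    if "phi'_graph p' s' t' m'" "length s' \<le> f" for p' s' t' m'
  proof -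
    have *: "distinct s'" "leaf_labels t' = set s'"
      using phi'_graph_positive[OF that(1)] by (auto simp: positive_def)
    have "phi'_aux f p' (map (lam_inv (set s')) s') = (relabel (lam_inv (set s')) t', m')"
      by (rule Suc.IH[OF phi'_graph_map[OF that(1)]]) (use standardise[OF *(1)] that in auto)
    then show ?thesis using standardise(3)[OF *(1,2)] by simp
  qed
  have rec': "relabel (lam (set s')) (phi_aux (length s') p' (map (lam_inv (set s')) s')) = t'"
    if "phi_graph p' s' t'" for p' s' t'
  proof -
    have *: "distinct s'" "leaf_labels t' = set s'"
      using phi_graph_motzkin[OF that(1)] by (auto simp: motzkin_def)
    have "phi_aux (length s') p' (map (lam_inv (set s')) s') = relabel (lam_inv (set s')) t'"
      by (rule phi_aux_eq[OF phi_graph_map[OF that(1)]]) (use standardise[OF *(1)] that in auto)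
    then show ?thesis using standardise(3)[OF *(1,2)] by simp
  qed
  have rr: "map uminus (rev (rev_path p1)) = p1" for p1
    using rev_path_rev_path[of p1] by (simp add: rev_path_def)
  define k where "k = (GREATEST k. k \<le> length s \<and>
     (\<forall>j\<in>{2..k-1}. 1 \<le> sum_list (take (j - 1) p)) \<and> sum_list (take (k - 1) p) = 1)"
  from Suc.prems(1) show ?case
  proof cases
    case (phi'_graph_base a)
    then show ?thesis using Suc.prems by simp
  next
    case (phi'_graph_flat p' s' t' m' a)
    have "s' \<noteq> []" using phi'_graph_positive[OF phi'_graph_flat(5)] positive_length by force
    moreover have "{1..length s} - {a} = set s'" using Suc.prems(2)[symmetric] phi'_graph_flat
      by auto
    ultimately show ?thesis
      using rec[OF phi'_graph_flat(5)] Suc.prems(3) phi'_graph_flat by (simp add: Let_def)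
  next
    case (phi'_graph_root p1 s1)
    have m: "motzkin p1 s1" using phi_graph_motzkin phi'_graph_root by auto
    then have len: "length s1 = Suc (length p1)" "1 \<le> length p1" using motzkin_length by auto
    have k: "k = length s1"
      unfolding k_def phi'_graph_root(1,2) length_rev by (rule Greatest_last_one[OF m])
    have "phi_aux (length s1) p1 s1 = t"
      by (rule phi_aux_eq[OF phi'_graph_root(4)]) (use Suc.prems(2) phi'_graph_root(2) in auto)
    \<comment> \<open>In this branch the code does not rename back. The labels already fill
      \<open>{1..n}\<close>, so each is its own rank.\<close>
    moreover have "map (lam_inv (set s1)) s1 = s1"
    proof (rule map_idI)
      fix x assume "x \<in> set s1"
      then have "{y \<in> set s1. y \<le> x} = {1..x}" using Suc.prems(2) phi'_graph_root(2) by auto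
      then show "lam_inv (set s1) x = x" by (simp add: lam_inv_def)
    qed
    moreover have "hd p = 1" "length s \<noteq> 1"
      using rev_motzkin_hd[OF m(1)] len by (auto simp: phi'_graph_root(1,2))
    moreover have "take k s = rev s1" "take (k - 1) p = rev_path p1" "k = length s"
      by (auto simp: k len phi'_graph_root(1,2))
    ultimately show ?thesis
      unfolding phi'_aux.simps(2) Let_def k_def[symmetric] by (simp add: phi'_graph_root(3) rr)
  next
    case (phi'_graph_up p1 s1 t1 p2 s2 t2 m2)
    have m: "motzkin p1 s1" "positive p2 s2"
      using phi_graph_motzkin phi'_graph_positive phi'_graph_up by auto
    then have len: "length s1 = Suc (length p1)" "length s2 = Suc (length p2)" "1 \<le> length p1"
      using motzkin_length positive_length by auto
    have k: "k = length s1"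
      unfolding k_def phi'_graph_up(1,2) by (rule Greatest_last_one_append[OF m]) auto
    have "take k s = rev s1" "drop k s = s2" "take (k - 1) p = rev_path p1" "drop k p = p2"
        "k \<noteq> length s"
      by (auto simp: k len phi'_graph_up(1,2))
    moreover have "hd p = 1" "length s \<noteq> 1"
      using rev_motzkin_hd[OF m(1)] len by (auto simp: phi'_graph_up(1,2))
    moreover have "length s2 \<le> f" using Suc.prems(3) len by (auto simp: phi'_graph_up(2))
    ultimately show ?thesis
      using rec'[OF phi'_graph_up(5)] rec[OF phi'_graph_up(6)]
      unfolding phi'_aux.simps(2) Let_def k_def[symmetric] by (simp add: phi'_graph_up(3,4) rr)
  qed
qed

section \<open>Recovering the path from an unordered tree\<close>

lemma leaf_labels_subtree_at: "leaf_labels (subtree_at t q) \<subseteq> leaf_labels t"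
  by (induction t q rule: subtree_at.induct) auto

lemma Nil_in_positions [simp]: "[] \<in> positions t"
  by (cases t) auto

text \<open>A proper subtree lies in one child of the root and misses the leaves of the other child,
  of which there is at least one.\<close>

lemma subtree_at_whole_iff:
  assumes "distinct_leaves t" "q \<in> positions t"
  shows "leaf_labels (subtree_at t q) = leaf_labels t \<longleftrightarrow> q = []"
proof (cases q)
  case (Cons b q')
  then obtain l r where t: "t = Node l r" using assms(2) by (cases t) auto
  have "leaf_labels (subtree_at t q) \<subseteq> leaf_labels (if b then r else l)"
    using leaf_labels_subtree_at by (auto simp: t Cons)
  moreover have "leaf_labels t - leaf_labels (if b then r else l) \<noteq> {}"
    using assms(1) leaf_labels_nonempty[of l] leaf_labels_nonempty[of r]
    by (auto simp: t simp del: leaf_labels_nonempty)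
  ultimately show ?thesis using Cons by auto
qed simp

text \<open>The mark lies in the second child of both trees. In the swapped alignment the leaves
  below it would belong to \<open>u\<close> as well as to \<open>t\<close>, but these are disjoint
  and the set is not empty.\<close>

lemma sim_Node_marked:
  assumes "sim (Node u t) (Node u2 t2)" "distinct_leaves (Node u t)"
    "leaf_labels (subtree_at t m) = leaf_labels (subtree_at t2 m2)"
  shows "sim u u2 \<and> sim t t2"
proof -
  consider "sim u u2" "sim t t2" | "sim u t2" "sim t u2" using assms(1) by (auto elim: sim_NodeE)
  then show ?thesis
  proof cases
    case 2
    then have "leaf_labels t2 = leaf_labels u" using leaf_labels_sim by auto
    then have "leaf_labels (subtree_at t m) \<subseteq> leaf_labels t \<inter> leaf_labels u"
      using assms(3) leaf_labels_subtree_at[of t m] leaf_labels_subtree_at[of t2 m2] by auto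
    then show ?thesis using assms(2) leaf_labels_nonempty[of "subtree_at t m"]
      by (auto simp del: leaf_labels_nonempty)
  qed auto
qed

text \<open>The number of leaves among the two children of the root tells which rule was used, since
  every tree of a Motzkin path is a \<open>Node\<close>: two for the base rule, one for the flat
  rule, none for the up rule.\<close>

lemma phi_graph_inj:
  "phi_graph p s t \<Longrightarrow> phi_graph p' s' t' \<Longrightarrow> sim t t' \<Longrightarrow> p = p' \<and> s = s'"
proof (induction arbitrary: p' s' t' rule: phi_graph.induct)
  case (phi_graph_base a b)
  from phi_graph_base.prems phi_graph_base.hyps show ?case
    by (auto elim!: sim_NodeE sim_LeafE elim!: phi_graph.cases dest: phi_graph_is_Node)
next
  case (phi_graph_flat p s t a)
  from phi_graph_flat.hyps obtain l r where "t = Node l r" using phi_graph_is_Node by blast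
  then have notleaf: "\<not> sim t (Leaf c)" for c by (auto elim!: sim_NodeE)
  from phi_graph_flat.prems(2) have *: "\<exists>t2. sim t t2 \<and> (t' = Node (Leaf a) t2 \<or> t' = Node t2 (Leaf a))"
    by (auto elim!: sim_NodeE[of "Leaf a"] sim_LeafE)
  from phi_graph_flat.prems(1) show ?case
  proof cases
    case (phi_graph_base b c)
    then show ?thesis using * notleaf by auto
  next
    case (phi_graph_flat p2 s2 t2 b)
    then show ?thesis using * notleaf phi_graph_flat.IH[of p2 s2 t2] by auto
  next
    case (phi_graph_up p1 s1 t1 p2 s2 t2)
    then show ?thesis using * phi_graph_is_Node by blast
  qed
next
  case (phi_graph_up p s t p2 s2 t2)
  from phi_graph_up.hyps obtain l r l2 r2 where tt: "t = Node l r" "t2 = Node l2 r2"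
    using phi_graph_is_Node by meson
  have notleaf: "\<not> sim t (Leaf c)" "\<not> sim t2 (Leaf c)" for c
    unfolding tt by (auto elim!: sim_NodeE)
  from phi_graph_up.prems(1) show ?case
  proof cases
    case (phi_graph_base a b)
    then show ?thesis using phi_graph_up.prems(2) notleaf by (auto elim!: sim_NodeE)
  next
    case (phi_graph_flat p s t a)
    then show ?thesis using phi_graph_up.prems(2) notleaf by (auto elim!: sim_NodeE)
  next
    case (phi_graph_up p3 s3 t3 p4 s4 t4)
    then consider "sim t t3" "sim t2 t4" | "sim t t4" "sim t2 t3"
      using phi_graph_up.prems(2) by (auto elim: sim_NodeE)
    then show ?thesis
    proof cases
      case 1
      then show ?thesis using phi_graph_up.IH phi_graph_up by blast
    next
      case 2
      \<comment> \<open>A swapped alignment would, by induction, exchange the two pieces and so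
        reverse the strict comparison of their heads.\<close>
      then show ?thesis using phi_graph_up.IH(1)[of p4 s4 t4] phi_graph_up.IH(2)[of p3 s3 t3] phi_graph_up
        phi_graph_up.hyps by auto
    qed
  qed
qed

text \<open>A mark at the root singles out \<open>phi'_graph_base\<close> and
  \<open>phi'_graph_root\<close>. Otherwise the mark tells which child is which, and the child
  without it is a leaf for \<open>phi'_graph_flat\<close> and a \<open>Node\<close> for
  \<open>phi'_graph_up\<close>.\<close>

lemma phi'_graph_inj:
  "phi'_graph p s t m \<Longrightarrow> phi'_graph p' s' t' m' \<Longrightarrow> sim t t' \<Longrightarrow>
    leaf_labels (subtree_at t m) = leaf_labels (subtree_at t' m') \<Longrightarrow> p = p' \<and> s = s'"
proof (induction arbitrary: p' s' t' m' rule: phi'_graph.induct)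
  case (phi'_graph_base a)
  then have "t' = Leaf a" by (auto elim: sim_LeafE)
  with phi'_graph_base.prems(1) show ?case by cases (auto dest: phi_graph_is_Node)
next
  case (phi'_graph_flat p s t m a)
  have d: "distinct_leaves (Node (Leaf a) t)" "m \<in> positions t"
    using phi'_graph_positive[OF phi'_graph.phi'_graph_flat[OF phi'_graph_flat.hyps]] by auto
  from phi'_graph_flat.prems(1) show ?case
  proof cases
    case phi'_graph_base
    then show ?thesis using phi'_graph_flat.prems(2) by (auto elim: sim_NodeE)
  next
    case (phi'_graph_flat p2 s2 t2 m2 b)
    have "sim (Leaf a) (Leaf b) \<and> sim t t2"
      using phi'_graph_flat.prems d phi'_graph_flat
      by (intro sim_Node_marked[where m = m and ?m2.0 = m2]) auto
    then show ?thesis using phi'_graph_flat.IH[of p2 s2 t2 m2] phi'_graph_flat phi'_graph_flat.prems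
      by (auto elim: sim_LeafE)
  next
    case (phi'_graph_root p5 s5)
    then show ?thesis
      using phi'_graph_flat.prems d subtree_at_whole_iff[OF d(1), of "True # m"]
        leaf_labels_sim[OF phi'_graph_flat.prems(2)] by simp
  next
    case (phi'_graph_up p1 s1 t1 p2 s2 t2 m2)
    have "sim (Leaf a) t1 \<and> sim t t2"
      using phi'_graph_flat.prems d phi'_graph_up
      by (intro sim_Node_marked[where m = m and ?m2.0 = m2]) auto
    then show ?thesis using phi_graph_is_Node[OF phi'_graph_up(5)] by (auto elim: sim_LeafE)
  qed
next
  case (phi'_graph_root p s t)
  have t': "distinct_leaves t'" "m' \<in> positions t'" "leaf_labels t = leaf_labels t'"
    using phi'_graph_positive[OF phi'_graph_root.prems(1)] leaf_labels_sim[OF phi'_graph_root.prems(2)] by auto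
  then have "m' = []"
    using phi'_graph_root.prems(3) subtree_at_whole_iff[OF t'(1,2)] by (metis subtree_at.simps(1))
  with phi'_graph_root.prems(1) show ?case
  proof cases
    case phi'_graph_base
    then show ?thesis using phi_graph_is_Node[OF phi'_graph_root.hyps] phi'_graph_root.prems(2)
      by (auto elim: sim_NodeE)
  next
    case (phi'_graph_root p2 s2)
    then show ?thesis using phi_graph_inj phi'_graph_root.hyps phi'_graph_root.prems(2) by blast
  qed auto
next
  case (phi'_graph_up p s t p2 s2 t2 m)
  have d: "distinct_leaves (Node t t2)" "m \<in> positions t2"
    using phi'_graph_positive[OF phi'_graph.phi'_graph_up[OF phi'_graph_up.hyps]] by auto
  from phi'_graph_up.prems(1) show ?case
  proof cases
    case phi'_graph_base
    then show ?thesis using phi'_graph_up.prems(2) by (auto elim: sim_NodeE)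
  next
    case (phi'_graph_flat p3 s3 t3 m3 b)
    have "sim t (Leaf b) \<and> sim t2 t3"
      using phi'_graph_up.prems d phi'_graph_flat
      by (intro sim_Node_marked[where m = m and ?m2.0 = m3]) auto
    then show ?thesis using phi_graph_is_Node[OF phi'_graph_up.hyps(1)] by (auto elim: sim_NodeE)
  next
    case (phi'_graph_root p5 s5)
    then show ?thesis
      using phi'_graph_up.prems d subtree_at_whole_iff[OF d(1), of "True # m"]
        leaf_labels_sim[OF phi'_graph_up.prems(2)] by simp
  next
    case (phi'_graph_up p3 s3 t3 p4 s4 t4 m4)
    have "sim t t3 \<and> sim t2 t4"
      using phi'_graph_up.prems d phi'_graph_up
      by (intro sim_Node_marked[where m = m and ?m2.0 = m4]) auto
    then show ?thesis using phi'_graph_up.IH[of p4 s4 t4 m4] phi_graph_inj[OF phi'_graph_up.hyps(1), of p3 s3 t3]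
      phi'_graph_up phi'_graph_up.prems by auto
  qed
qed

section \<open>Every unordered tree comes from a path\<close>

text \<open>The children can be put into the order that the path rules demand, a leaf or the smaller
  head first, because \<open>sim_swap\<close> absorbs the exchange.\<close>

lemma ex_phi_graph:
  "distinct_leaves t \<Longrightarrow> \<nexists>a. t = Leaf a \<Longrightarrow> \<exists>p s t'. phi_graph p s t' \<and> sim t' t"
proof (induction t)
  case (Node l r)
  have path: "(\<exists>a. u = Leaf a) \<or> (\<exists>p s t'. phi_graph p s t' \<and> sim t' u)" if "u \<in> {l, r}" for u
    using that Node by auto
  have lr: "leaf_labels l \<inter> leaf_labels r = {}" using Node.prems by simp
  have disj: "set s \<inter> set s' = {}" "hd s \<noteq> hd s'"
    if "phi_graph p s t" "sim t l" "phi_graph p' s' t'" "sim t' r" for p s t p' s' t'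
  proof -
    show "set s \<inter> set s' = {}" using lr that phi_graph_motzkin leaf_labels_sim by metis
    then show "hd s \<noteq> hd s'" using that phi_graph_motzkin motzkin_nonempty hd_in_set
      by (metis disjoint_iff)
  qed
  consider (LL) a b where "l = Leaf a" "r = Leaf b"
    | (LN) a p s t' where "l = Leaf a" "phi_graph p s t'" "sim t' r"
    | (NL) a p s t' where "r = Leaf a" "phi_graph p s t'" "sim t' l"
    | (NN) p s t' p' s' t'' where "phi_graph p s t'" "sim t' l" "phi_graph p' s' t''" "sim t'' r"
    using path[of l] path[of r] by blast
  then show ?case
  proof cases
    case LL
    show ?thesis
    proof (cases "a < b")
      case True
      with phi_graph_base[OF True] sim_Node[OF sim_Leaf sim_Leaf] LL show ?thesis by blast
    next
      case False
      then have "b < a" using Node.prems(1) LL by auto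
      with phi_graph_base[OF this] sim_swap[OF sim_Leaf sim_Leaf] LL show ?thesis by blast
    qed
  next
    case LN
    then have "a \<notin> set s" using Node.prems phi_graph_motzkin leaf_labels_sim by fastforce
    with LN show ?thesis using phi_graph_flat sim_Node[OF sim_Leaf] by blast
  next
    case NL
    then have "a \<notin> set s" using Node.prems phi_graph_motzkin leaf_labels_sim by fastforce
    with NL show ?thesis using phi_graph_flat sim_swap[OF sim_Leaf] by blast
  next
    case NN
    note d = disj[OF NN]
    show ?thesis
    proof (cases "hd s < hd s'")
      case True
      with phi_graph_up[OF NN(1,3) d(1)] sim_Node[OF NN(2,4)] show ?thesis by blast
    next
      case False
      with d have "set s' \<inter> set s = {}" "hd s' < hd s" by auto
      with phi_graph_up[OF NN(3,1)] sim_swap[OF NN(4,2)] show ?thesis by blast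
    qed
  qed
qed simp

lemma ex_phi'_graph:
  "distinct_leaves t \<Longrightarrow> q \<in> positions t \<Longrightarrow> \<exists>p s t' m. phi'_graph p s t' m \<and> sim t' t \<and>
     leaf_labels (subtree_at t' m) = leaf_labels (subtree_at t q)"
proof (induction t arbitrary: q)
  case (Leaf a)
  then show ?case using phi'_graph_base sim_Leaf by force
next
  case (Node l r)
  show ?case
  proof (cases q)
    case Nil
    obtain p s t' where "phi_graph p s t'" "sim t' (Node l r)" using ex_phi_graph[OF Node.prems(1)]
      by blast
    then show ?thesis using phi'_graph_root Nil leaf_labels_sim subtree_at.simps(1) by metis
  next
    case (Cons b q')
    \<comment> \<open>\<open>c\<close> is the child containing the marked vertex. It always becomes
      the right child, where the rules expect the mark.\<close>
    define c where "c = (if b then r else l)"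
    define u where "u = (if b then l else r)"
    have c: "distinct_leaves c" "q' \<in> positions c" and u: "distinct_leaves u"
      "leaf_labels u \<inter> leaf_labels c = {}"
      using Node.prems Cons by (auto simp: c_def u_def split: if_splits)
    have "\<exists>p s t' m. phi'_graph p s t' m \<and> sim t' c \<and>
        leaf_labels (subtree_at t' m) = leaf_labels (subtree_at c q')"
      using Node.IH c by (auto simp: c_def split: if_splits)
    then obtain p s t' m where *: "phi'_graph p s t' m" "sim t' c"
        "leaf_labels (subtree_at t' m) = leaf_labels (subtree_at c q')" by blast
    have whole: "sim (Node u' t') (Node l r)" if "sim u' u" for u'
      using that *(2) by (auto simp: c_def u_def intro: sim.intros split: if_splits)
    have sub: "leaf_labels (subtree_at (Node u' t') (True # m)) =
        leaf_labels (subtree_at (Node l r) q)" for u'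
      using * Cons by (simp add: c_def)
    show ?thesis
    proof (cases u)
      case (Leaf a)
      then have "a \<notin> set s" using u phi'_graph_positive[OF *(1)] leaf_labels_sim[OF *(2)] by auto
      with phi'_graph_flat[OF *(1)] whole[OF sim_Leaf[of a, folded Leaf]] sub show ?thesis
        using Leaf by blast
    next
      case (Node u1 u2)
      then obtain p1 s1 t1 where t1: "phi_graph p1 s1 t1" "sim t1 u" using ex_phi_graph[OF u(1)]
        by blast
      then have "set s1 \<inter> set s = {}"
        using u phi'_graph_positive[OF *(1)] leaf_labels_sim[OF *(2)] phi_graph_motzkin[OF t1(1)]
          leaf_labels_sim[OF t1(2)] by auto
      with phi'_graph_up[OF t1(1) *(1)] whole[OF t1(2)] sub show ?thesis by blast
    qed
  qed
qed

section \<open>The greedy labelling\<close>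

definition inner :: "ltree \<Rightarrow> bool list set" where
  "inner t = {q \<in> positions t. \<exists>l r. subtree_at t q = Node l r}"

lemma inner_simps [simp]:
  "inner (Leaf a) = {}"
  "inner (Node l r) = {[]} \<union> Cons False ` inner l \<union> Cons True ` inner r"
  by (auto simp: inner_def)

lemma inner_subset: "inner t \<subseteq> positions t"
  by (auto simp: inner_def)

lemma finite_positions [simp]: "finite (positions t)"
  by (induction t) auto

lemma finite_inner [simp]: "finite (inner t)"
  using finite_subset[OF inner_subset] by simp

lemma card_positions: "Suc (card (positions t)) = 2 * nleaves t"
proof (induction t)
  case (Node l r)
  have "card (positions (Node l r)) =
    card (Cons False ` positions l \<union> Cons True ` positions r) + 1"
    by (auto simp: card_insert_if)
  also have "card (Cons False ` positions l \<union> Cons True ` positions r) =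
    card (Cons False ` positions l) + card (Cons True ` positions r)"
    by (rule card_Un_disjoint) auto
  finally show ?case using Node by (simp add: card_image)
qed simp

lemma card_inner: "Suc (card (inner t)) = nleaves t"
proof (induction t)
  case (Node l r)
  have "card (inner (Node l r)) = card (Cons False ` inner l \<union> Cons True ` inner r) + 1"
    by (auto simp: card_insert_if)
  also have "card (Cons False ` inner l \<union> Cons True ` inner r) =
    card (Cons False ` inner l) + card (Cons True ` inner r)"
    by (rule card_Un_disjoint) auto
  finally show ?case using Node by (simp add: card_image)
qed simp

lemma card_leaf_labels: "distinct_leaves t \<Longrightarrow> card (leaf_labels t) = nleaves t"
  by (induction t) (auto simp: card_Un_disjoint)

lemma snoc_in_positions [simp]: "q @ [x] \<in> positions t \<longleftrightarrow> q \<in> inner t"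
proof (induction t arbitrary: q)
  case (Leaf a)
  then show ?case by (cases q) auto
next
  case (Node l r)
  then show ?case by (cases q; cases "hd q"; cases x) auto
qed

lemma subtree_at_snoc:
  "subtree_at t q = Node l r \<Longrightarrow> subtree_at t (q @ [x]) = (if x then r else l)"
  by (induction t q rule: subtree_at.induct) auto

lemma positions_snocE:
  assumes "q \<in> positions t" "q \<noteq> []"
  obtains r x where "q = r @ [x]" "r \<in> inner t"
  using assms by (cases q rule: rev_cases) auto

lemma not_inner_iff:
  "q \<in> positions t \<Longrightarrow> q \<notin> inner t \<longleftrightarrow> (\<exists>a. subtree_at t q = Leaf a)"
  by (cases "subtree_at t q") (auto simp: inner_def)

lemma leaf_position_unique:
  "distinct_leaves t \<Longrightarrow> q \<in> positions t \<Longrightarrow> q' \<in> positions t \<Longrightarrow>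
    subtree_at t q = Leaf a \<Longrightarrow> subtree_at t q' = Leaf a \<Longrightarrow> q = q'"
proof (induction t arbitrary: q q')
  case (Node l r)
  have sub: "a \<in> leaf_labels u" if "subtree_at u p = Leaf a" for u p
    using leaf_labels_subtree_at[of u p] that by simp
  obtain b p b' p' where qq: "q = b # p" "q' = b' # p'"
    using Node.prems by (cases q; cases q') auto
  have "b = b'"
    using Node.prems sub[of l] sub[of r] unfolding qq by (cases b; cases b') auto
  then show ?case
    using Node.prems Node.IH[of p p'] unfolding qq by (cases b) auto
qed simp

lemma leaf_position_exists: "a \<in> leaf_labels t \<Longrightarrow> \<exists>q\<in>positions t. subtree_at t q = Leaf a"
proof (induction t)
  case (Node l r)
  then consider q where "q \<in> positions l" "subtree_at l q = Leaf a"
    | q where "q \<in> positions r" "subtree_at r q = Leaf a" by auto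
  then show ?case
  proof cases
    case 1
    then show ?thesis by (intro bexI[of _ "False # q"]) auto
  next
    case 2
    then show ?thesis by (intro bexI[of _ "True # q"]) auto
  qed
qed auto

lemma distinct_leavesI:
  "(\<And>q q' a. q \<in> positions t \<Longrightarrow> q' \<in> positions t \<Longrightarrow> subtree_at t q = Leaf a \<Longrightarrow>
      subtree_at t q' = Leaf a \<Longrightarrow> q = q') \<Longrightarrow> distinct_leaves t"
proof (induction t)
  case (Node l r)
  have "distinct_leaves l"
  proof (rule Node.IH(1))
    fix q q' a
    assume "q \<in> positions l" "q' \<in> positions l" "subtree_at l q = Leaf a" "subtree_at l q' = Leaf a"
    then show "q = q'" using Node.prems[of "False # q" "False # q'" a] by auto
  qed
  moreover have "distinct_leaves r"
  proof (rule Node.IH(2))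
    fix q q' a
    assume "q \<in> positions r" "q' \<in> positions r" "subtree_at r q = Leaf a" "subtree_at r q' = Leaf a"
    then show "q = q'" using Node.prems[of "True # q" "True # q'" a] by auto
  qed
  moreover have "a \<notin> leaf_labels r" if "a \<in> leaf_labels l" for a
  proof
    assume "a \<in> leaf_labels r"
    with that obtain q q' where "q \<in> positions l" "subtree_at l q = Leaf a"
      "q' \<in> positions r" "subtree_at r q' = Leaf a" using leaf_position_exists by blast
    then show False using Node.prems[of "False # q" "True # q'" a] by auto
  qed
  ultimately show ?case by auto
qed simp

lemma sibling_snoc [simp]: "sibling (q @ [x]) = q @ [\<not> x]"
  by (simp add: sibling_def)

section \<open>Valid labellings and their uniqueness\<close>

definition min_child :: "(bool list \<Rightarrow> nat) \<Rightarrow> bool list \<Rightarrow> nat" where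
  "min_child L q = min (L (q @ [False])) (L (q @ [True]))"

text \<open>The labelling produced by the greedy procedure, axiomatically. Giving the root the
  otherwise unused label \<open>2 * n - 1\<close> lets every vertex be handled uniformly.\<close>
definition valid_lab :: "nat \<Rightarrow> ltree \<Rightarrow> (bool list \<Rightarrow> nat) \<Rightarrow> bool" where
  "valid_lab n t L \<longleftrightarrow> bij_betw L (positions t) {1..2*n-1} \<and> L [] = 2 * n - 1 \<and>
     (\<forall>q\<in>positions t. \<forall>a. subtree_at t q = Leaf a \<longrightarrow> L q = a \<and> a \<le> n) \<and>
     (\<forall>q\<in>inner t. n < L q \<and> (\<forall>x. L (q @ [x]) < L q)) \<and>
     (\<forall>q\<in>inner t. \<forall>q'\<in>inner t. L q < L q' \<longrightarrow> (\<forall>x. L (q' @ [x]) < L q) \<longrightarrow>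
        min_child L q < min_child L q')"

lemma valid_labD:
  assumes "valid_lab n t L"
  shows "bij_betw L (positions t) {1..2*n-1}" "L [] = 2 * n - 1"
    "q \<in> positions t \<Longrightarrow> subtree_at t q = Leaf a \<Longrightarrow> L q = a \<and> a \<le> n"
    "q \<in> inner t \<Longrightarrow> n < L q" "q \<in> inner t \<Longrightarrow> L (q @ [x]) < L q"
    "q \<in> inner t \<Longrightarrow> q' \<in> inner t \<Longrightarrow> L q < L q' \<Longrightarrow> (\<And>x. L (q' @ [x]) < L q) \<Longrightarrow>
      min_child L q < min_child L q'"
  using assms unfolding valid_lab_def by simp_all

text \<open>Suppose that the labels below \<open>i\<close> sit on the same vertices. If
  \<open>i\<close> is a leaf label, the tree fixes its place. Otherwise the vertices labelled
  \<open>i\<close> by \<open>L\<close> and by \<open>L'\<close> both have all their children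
  labelled below \<open>i\<close>. Were they different, each labelling would have preferred its own
  vertex, and the two opposite strict inequalities compare the same minima.\<close>

lemma valid_lab_unique:
  assumes L: "valid_lab n t L" and L': "valid_lab n t L'" and "q \<in> positions t"
  shows "L q = L' q"
proof -
  have "\<forall>q\<in>positions t. \<forall>q'\<in>positions t. L q = i \<longrightarrow> L' q' = i \<longrightarrow> q = q'" for i
  proof (induction i rule: less_induct)
    case (less i)
    show ?case
    proof (intro ballI impI, rule ccontr)
      fix q q' assume *: "q \<in> positions t" "q' \<in> positions t" "L q = i" "L' q' = i" "q \<noteq> q'"
      have bij: "bij_betw L (positions t) {1..2*n-1}" "bij_betw L' (positions t) {1..2*n-1}"
        using valid_labD(1) L L' by auto
      have im: "L ` positions t = L' ` positions t" using bij by (simp add: bij_betw_def)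
      have inj: "\<And>r r'. r \<in> positions t \<Longrightarrow> r' \<in> positions t \<Longrightarrow> L r = L r' \<Longrightarrow> r = r'"
        "\<And>r r'. r \<in> positions t \<Longrightarrow> r' \<in> positions t \<Longrightarrow> L' r = L' r' \<Longrightarrow> r = r'"
        using bij by (auto simp: bij_betw_def dest: inj_onD)
      \<comment> \<open>Both labellings have the same image, so a label below \<open>i\<close> used
        by one is used by the other, and the induction hypothesis puts both uses at one
        vertex.\<close>
      have agree: "L r = L' r" if r: "r \<in> positions t" "L r < i \<or> L' r < i" for r
      proof -
        have "L r \<in> L' ` positions t" "L' r \<in> L ` positions t" using im r by blast+
        then obtain r1 r2 where "r1 \<in> positions t" "L r = L' r1" "r2 \<in> positions t" "L' r = L r2"
          by blast
        then show ?thesis using less.IH[of "L r"] less.IH[of "L' r"] r by metis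
      qed
      have "q \<in> inner t \<longleftrightarrow> n < i" "q' \<in> inner t \<longleftrightarrow> n < i"
        using * valid_labD(3,4)[OF L, of q] valid_labD(3,4)[OF L', of q']
          not_inner_iff[of q t] not_inner_iff[of q' t] by (metis linorder_not_less)+
      then consider "q \<in> inner t" "q' \<in> inner t" | "q \<notin> inner t" "q' \<notin> inner t" by blast
      then show False
      proof cases
        case 2
        then obtain a b where "subtree_at t q = Leaf a" "subtree_at t q' = Leaf b"
          using * not_inner_iff by meson
        then have "L' q = a" "L q = a" using valid_labD(3) L L' * by blast+
        then have "L' q = L' q'" using * by simp
        then show False using inj(2) * by blast
      next
        case 1
        have lt: "L (q @ [x]) < i" "L' (q' @ [x]) < i" for x
          using valid_labD(5)[OF L 1(1)] valid_labD(5)[OF L' 1(2)] * by auto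
        then have ch: "L (q @ [x]) = L' (q @ [x])" "L (q' @ [x]) = L' (q' @ [x])" for x
          using agree 1 by simp_all
        \<comment> \<open>Labels below \<open>i\<close> agree, and \<open>L' q' = i\<close>, so
          \<open>L q'\<close> cannot be smaller than \<open>i\<close>: in \<open>L\<close>, the
          vertex \<open>q'\<close> comes after \<open>q\<close>. In \<open>L'\<close> it is the
          other way round.\<close>
        have "\<not> L q' < i" "L q' \<noteq> i" using agree[of q'] inj(1)[of q q'] * by auto
        then have "L q < L q'" using * by simp
        moreover have "\<not> L' q < i" "L' q \<noteq> i" using agree[of q] inj(2)[of q q'] * by auto
        then have "L' q' < L' q" using * by simp
        moreover have "L (q' @ [x]) < L q" "L' (q @ [x]) < L' q'" for x using lt[of x] ch[of x] *
          by auto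
        ultimately have "min_child L q < min_child L q'" "min_child L' q' < min_child L' q"
          using valid_labD(6)[OF L 1] valid_labD(6)[OF L' 1(2,1)] by auto
        then show False unfolding min_child_def ch by (meson less_asym)
      qed
    qed
  qed
  moreover have "L q \<in> L' ` positions t"
    using valid_labD(1)[OF L] valid_labD(1)[OF L'] assms(3) by (auto simp: bij_betw_def)
  then obtain q' where "q' \<in> positions t" "L q = L' q'" by blast
  ultimately show ?thesis using assms(3) by metis
qed

section \<open>Correctness of the iterative procedure\<close>

definition lab_inv :: "ltree \<Rightarrow> bool list set \<Rightarrow> (bool list \<Rightarrow> nat option) \<Rightarrow> bool" where
  "lab_inv t S lab \<longleftrightarrow> S \<subseteq> inner t - {[]} \<and>
     (\<forall>q. lab q \<noteq> None \<longleftrightarrow> q \<in> (positions t - inner t) \<union> S) \<and>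
     (\<forall>q\<in>positions t. \<forall>a. subtree_at t q = Leaf a \<longrightarrow> lab q = Some a) \<and>
     lab ` S = Some ` {nleaves t<..nleaves t + card S} \<and>
     (\<forall>q\<in>S. \<forall>x. lab (q @ [x]) \<noteq> None \<and> the (lab (q @ [x])) < the (lab q)) \<and>
     (\<forall>q\<in>S. \<forall>q'\<in>inner t - {[]}. q' \<notin> S \<or> the (lab q) < the (lab q') \<longrightarrow>
        (\<forall>x. lab (q' @ [x]) \<noteq> None \<and> the (lab (q' @ [x])) < the (lab q)) \<longrightarrow>
        min_child (the \<circ> lab) q < min_child (the \<circ> lab) q')"

lemma lab_inv_init: "lab_inv t {} (init_lab t)"
  unfolding lab_inv_def init_lab_def by (auto simp: inner_def split: ltree.splits)

lemma lab_inv_inj: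
  assumes inv: "lab_inv t S lab" and t: "distinct_leaves t" "leaf_labels t = {1..nleaves t}"
  shows "lab q = Some x \<Longrightarrow> x \<in> {1..nleaves t + card S}"
    and "lab q = Some x \<Longrightarrow> lab q' = Some x \<Longrightarrow> q = q'"
proof -
  have fin: "finite S" using inv finite_subset[of S "inner t"] by (auto simp: lab_inv_def)
  have image: "lab ` S = Some ` {nleaves t<..nleaves t + card S}" using inv
    by (simp add: lab_inv_def)
  \<comment> \<open>The image of \<open>S\<close> has as many elements as \<open>S\<close>, so no
    label is repeated there.\<close>
  have inj: "inj_on lab S"
    by (rule eq_card_imp_inj_on[OF fin]) (simp add: image card_image)
  have dom: "(\<exists>a. q \<in> positions t \<and> subtree_at t q = Leaf a \<and> x = a \<and> a \<in> {1..nleaves t}) \<or>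
      (q \<in> S \<and> nleaves t < x \<and> x \<le> nleaves t + card S)" if "lab q = Some x" for q x
  proof (cases "q \<in> S")
    case True
    then have "Some x \<in> Some ` {nleaves t<..nleaves t + card S}" using that image by force
    then show ?thesis using True by auto
  next
    case False
    then have "q \<in> positions t" "q \<notin> inner t" using inv that unfolding lab_inv_def by blast+
    then obtain a where a: "subtree_at t q = Leaf a" using not_inner_iff by blast
    moreover have "a \<in> {1..nleaves t}" using leaf_labels_subtree_at[of t q] a t by simp
    moreover have "lab q = Some a" using inv a \<open>q \<in> positions t\<close> unfolding lab_inv_def by blast
    ultimately show ?thesis using that \<open>q \<in> positions t\<close> by auto
  qed
  show "lab q = Some x \<Longrightarrow> x \<in> {1..nleaves t + card S}" using dom[of q x] by auto
  assume *: "lab q = Some x" "lab q' = Some x"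
  show "q = q'"
    using dom[OF *(1)] dom[OF *(2)] leaf_position_unique[OF t(1)] inj_onD[OF inj, of q q'] * by auto
qed

lemma lab_inv_step:
  assumes inv: "lab_inv t S lab" and t: "distinct_leaves t" "leaf_labels t = {1..nleaves t}"
    and "card S < card (inner t - {[]})"
  shows "\<exists>q0. q0 \<notin> S \<and> lab_inv t (insert q0 S) (lab_step t lab)"
proof -
  let ?n = "nleaves t" let ?s = "card S"
  note inj = lab_inv_inj[OF inv t]
  note conjs = inv[unfolded lab_inv_def]
  note SN = conjs[THEN conjunct1]
  note dom = conjs[THEN conjunct2, THEN conjunct1, rule_format]
  note leaf = conjs[THEN conjunct2, THEN conjunct2, THEN conjunct1, rule_format]
  note image = conjs[THEN conjunct2, THEN conjunct2, THEN conjunct2, THEN conjunct1]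
  note child = conjs[THEN conjunct2, THEN conjunct2, THEN conjunct2, THEN conjunct2, THEN conjunct1,
      rule_format]
  note order = conjs[THEN conjunct2, THEN conjunct2, THEN conjunct2, THEN conjunct2, THEN conjunct2,
      rule_format]
  have fin: "finite S" using SN finite_subset[of S "inner t"] by auto
  define E where "E = {q \<in> positions t. q \<noteq> [] \<and> lab q = None \<and>
    lab (q @ [False]) \<noteq> None \<and> lab (q @ [True]) \<noteq> None}"
  have E_iff: "q \<in> E \<longleftrightarrow> q \<in> inner t - {[]} \<and> q \<notin> S \<and> (\<forall>x. lab (q @ [x]) \<noteq> None)" for q
    using dom[of q] SN inner_subset[of t] unfolding E_def by (auto simp: all_bool_eq)
  have "inner t - {[]} - S \<noteq> {}" using assms(4) fin by (metis Diff_eq_empty_iff card_mono leD)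
  \<comment> \<open>A deepest unlabelled internal vertex is eligible: each of its children is a
    leaf, or is internal and deeper and therefore labelled already.\<close>
  then have "Max (length ` (inner t - {[]} - S)) \<in> length ` (inner t - {[]} - S)"
    by (intro Max_in) auto
  then obtain qm where qm: "qm \<in> inner t - {[]} - S"
    and qm_Max: "Max (length ` (inner t - {[]} - S)) = length qm" by (rule imageE)
  have deepest: "length q \<le> length qm" if "q \<in> inner t - {[]} - S" for q
    unfolding qm_Max[symmetric] using that by (intro Max_ge) auto
  have "qm \<in> E"
    unfolding E_iff
  proof (intro conjI allI)
    fix x show "lab (qm @ [x]) \<noteq> None"
    proof (cases "qm @ [x] \<in> inner t")
      case True
      then have "qm @ [x] \<in> S" using deepest[of "qm @ [x]"] by auto
      then show ?thesis using dom by blast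
    next
      case False
      then show ?thesis using qm dom snoc_in_positions[of qm x t] by blast
    qed
  qed (use qm in auto)
  then have E: "E \<noteq> {}" "finite E" by (auto simp: E_def)
  define f where "f q = min (the (lab (q @ [False]))) (the (lab (q @ [True])))" for q
  define q0 where "q0 = arg_min_on f E"
  define v where "v = (LEAST x. ?n < x \<and> x \<le> 2 * ?n - 2 \<and> (\<forall>q. lab q \<noteq> Some x))"
  have q0: "q0 \<in> E" and q0_min: "\<And>q. q \<in> E \<Longrightarrow> f q0 \<le> f q"
    using arg_min_if_finite[OF E(2,1), of f] unfolding q0_def by (auto simp: not_less)
  have step: "lab_step t lab = lab(q0 := Some v)"
    using E unfolding lab_step_def Let_def E_def[symmetric] q0_def v_def f_def by simp
  have cardN: "card (inner t - {[]}) \<le> ?n - 2"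
  proof (cases t)
    case (Node l r)
    then have "[] \<in> inner t" by simp
    then show ?thesis using card_inner[of t] by (simp add: card_Diff_singleton)
  qed simp
  \<comment> \<open>The labels in use fill an initial segment. The bound \<open>2 * ?n - 2\<close>
    is respected because at most \<open>?n - 2\<close> internal vertices lie below the root and one
    of them is still unlabelled.\<close>
  have v: "v = ?n + ?s + 1"
    unfolding v_def
  proof (rule Least_equality)
    show "?n < ?n + ?s + 1 \<and> ?n + ?s + 1 \<le> 2 * ?n - 2 \<and> (\<forall>q. lab q \<noteq> Some (?n + ?s + 1))"
      using assms(4) cardN inj(1) by fastforce
    fix y assume y: "?n < y \<and> y \<le> 2 * ?n - 2 \<and> (\<forall>q. lab q \<noteq> Some y)"
    show "?n + ?s + 1 \<le> y"
    proof (rule ccontr)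
      assume "\<not> ?n + ?s + 1 \<le> y"
      then have "Some y \<in> lab ` S" using y unfolding image by auto
      then show False using y by (auto simp: image_iff)
    qed
  qed
  have q0N: "q0 \<in> inner t - {[]}" "q0 \<notin> S" "\<And>x. lab (q0 @ [x]) \<noteq> None" "lab q0 = None"
    using q0 E_iff dom[of q0] by auto
  have old_less: "the (lab q) < v" if "lab q \<noteq> None" for q using inj(1) that v by fastforce
  let ?lab = "lab(q0 := Some v)"
  \<comment> \<open>The children of vertices in \<open>insert q0 S\<close> had labels before the
    step, whereas \<open>q0\<close> had none, so the update does not touch them.\<close>
  have child': "?lab (q @ [x]) = lab (q @ [x])" if "q \<in> insert q0 S" for q x
    using child[of q x] that q0N(4) by (cases "q @ [x] = q0") auto
  have min': "min_child (the \<circ> ?lab) q = min_child (the \<circ> lab) q" if "\<And>x. ?lab (q @ [x]) = lab (q @ [x])" for q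
    using that unfolding min_child_def comp_def by metis
  have "lab_inv t (insert q0 S) ?lab"
    unfolding lab_inv_def
  proof (intro conjI ballI allI impI)
    show "insert q0 S \<subseteq> inner t - {[]}" using SN q0N by auto
    show "?lab q \<noteq> None \<longleftrightarrow> q \<in> (positions t - inner t) \<union> insert q0 S" for q
      using dom[of q] by auto
    show "?lab q = Some a" if "q \<in> positions t" "subtree_at t q = Leaf a" for q a
      using leaf[OF that] q0N that by auto
    have "?lab ` insert q0 S = insert (Some v) (lab ` S)" using q0N by (auto simp: image_iff)
    also have "\<dots> = Some ` insert v {?n<..?n + ?s}" using image by simp
    also have "insert v {?n<..?n + ?s} = {?n<..?n + card (insert q0 S)}"
      using q0N fin v by auto
    finally show "?lab ` insert q0 S = Some ` {?n<..?n + card (insert q0 S)}" .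
    show "?lab (q @ [x]) \<noteq> None" if "q \<in> insert q0 S" for q x
      unfolding child'[OF that] using child[of q x] q0N that by auto
    show "the (?lab (q @ [x])) < the (?lab q)" if "q \<in> insert q0 S" for q x
      unfolding child'[OF that] using child[of q x] q0N that old_less by auto
  next
    fix q q' assume q: "q \<in> insert q0 S" and q': "q' \<in> inner t - {[]}"
      and new: "q' \<notin> insert q0 S \<or> the (?lab q) < the (?lab q')"
      and ch: "\<forall>x. ?lab (q' @ [x]) \<noteq> None \<and> the (?lab (q' @ [x])) < the (?lab q)"
    have le_v: "the (?lab r) \<le> v" if "r \<in> insert q0 S" for r
      using that old_less[of r] dom[of r] by auto
    \<comment> \<open>A child of \<open>q'\<close> carries a label below that of \<open>q\<close>,
      which is at most \<open>v\<close>; so this child is not \<open>q0\<close>.\<close>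
    have ch': "?lab (q' @ [x]) = lab (q' @ [x])" for x
      using ch[rule_format, of x] le_v[OF q] by (cases "q' @ [x] = q0") auto
    show "min_child (the \<circ> ?lab) q < min_child (the \<circ> ?lab) q'"
      unfolding min'[OF child'[OF q]] min'[OF ch']
    proof (cases "q = q0")
      case False
      then have qS: "q \<in> S" using q by auto
      show "min_child (the \<circ> lab) q < min_child (the \<circ> lab) q'"
      proof (rule order[OF qS q'])
        show "q' \<notin> S \<or> the (lab q) < the (lab q')"
          using new False q0N by (cases "q' = q0") auto
        show "lab (q' @ [x]) \<noteq> None \<and> the (lab (q' @ [x])) < the (lab q)" for x
          using ch[rule_format, of x] unfolding ch' using False by simp
      qed
    next
      case True
      \<comment> \<open>No label exceeds \<open>v\<close>, so \<open>q'\<close> is still unlabelled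
        after the step and competed with \<open>q0\<close>.\<close>
      have "q' \<notin> insert q0 S"
        using new le_v[of q'] True by auto
      then have "q' \<in> E" using q' ch unfolding E_iff ch' by auto
      then have le: "f q0 \<le> f q'" by (rule q0_min)
      \<comment> \<open>\<open>q0\<close> only has a minimum in the weak sense. Strictness comes
        from injectivity: equal minima would be one label on children of two different
        parents.\<close>
      have "f q0 \<noteq> f q'"
      proof
        assume "f q0 = f q'"
        then obtain x y where "the (lab (q0 @ [x])) = the (lab (q' @ [y]))"
          unfolding f_def min_def by (metis)
        then have "lab (q0 @ [x]) = lab (q' @ [y])" using q0N(3)[of x] ch unfolding ch' by force
        moreover obtain z where z: "lab (q0 @ [x]) = Some z" using q0N(3)[of x] by blast
        ultimately have "lab (q' @ [y]) = Some z" by simp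
        with z have "q0 @ [x] = q' @ [y]" by (rule inj(2))
        then show False using \<open>q' \<notin> insert q0 S\<close> by simp
      qed
      then have "f q0 < f q'" using le by simp
      then show "min_child (the \<circ> lab) q < min_child (the \<circ> lab) q'"
        unfolding True f_def min_child_def comp_def .
    qed
  qed
  with q0N step show ?thesis by auto
qed

lemma lab_step_stable:
  assumes inv: "lab_inv t S lab" and "card S = card (inner t - {[]})"
  shows "lab_step t lab = lab"
proof -
  have "S = inner t - {[]}"
    using assms by (intro card_subset_eq) (auto simp: lab_inv_def)
  then have "lab q \<noteq> None" if "q \<in> positions t" "q \<noteq> []" for q
    using inv[unfolded lab_inv_def, THEN conjunct2, THEN conjunct1] that by blast
  then have "{q \<in> positions t. q \<noteq> [] \<and> lab q = None \<and>
    lab (q @ [False]) \<noteq> None \<and> lab (q @ [True]) \<noteq> None} = {}" by blast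
  then show ?thesis unfolding lab_step_def Let_def by simp
qed

text \<open>The \<open>min\<close> records that the procedure is stationary once all internal
  non-root vertices are labelled; \<open>full_lab\<close> performs at least that many steps.\<close>

lemma lab_inv_iterate:
  assumes t: "distinct_leaves t" "leaf_labels t = {1..nleaves t}"
  shows "\<exists>S. card S = min k (card (inner t - {[]})) \<and> lab_inv t S ((lab_step t ^^ k) (init_lab t))"
proof (induction k)
  case 0
  show ?case using lab_inv_init by (intro exI[of _ "{}"]) auto
next
  case (Suc k)
  let ?N = "card (inner t - {[]})"
  from Suc obtain S where S: "card S = min k ?N" "lab_inv t S ((lab_step t ^^ k) (init_lab t))"
    by blast
  have fin: "finite S" using S(2) finite_subset[of S "inner t"] by (auto simp: lab_inv_def)
  show ?case
  proof (cases "k < ?N")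
    case True
    then obtain q0 where "q0 \<notin> S" "lab_inv t (insert q0 S) ((lab_step t ^^ Suc k) (init_lab t))"
      using lab_inv_step[OF S(2) t] S(1) by auto
    then show ?thesis using S(1) True fin by (intro exI[of _ "insert q0 S"]) auto
  next
    case False
    then have "lab_step t ((lab_step t ^^ k) (init_lab t)) = (lab_step t ^^ k) (init_lab t)"
      using lab_step_stable[OF S(2)] S(1) by simp
    then show ?thesis using S False by (intro exI[of _ S]) auto
  qed
qed

lemma full_lab_inv:
  assumes t: "distinct_leaves t" "leaf_labels t = {1..nleaves t}"
  shows "lab_inv t (inner t - {[]}) (full_lab t)"
proof -
  let ?N = "card (inner t - {[]})"
  have "?N \<le> card (positions t)" using inner_subset[of t] by (intro card_mono) auto
  then obtain S where S: "card S = ?N" "lab_inv t S (full_lab t)"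
    using lab_inv_iterate[OF t, of "card (positions t)"] unfolding full_lab_def by auto
  then have "S = inner t - {[]}"
    by (intro card_subset_eq) (auto simp: lab_inv_def)
  then show ?thesis using S by simp
qed

lemma full_lab_valid:
  assumes t: "distinct_leaves t" "leaf_labels t = {1..n}"
  obtains L where "valid_lab n t L" "\<And>q. q \<in> positions t \<Longrightarrow> q \<noteq> [] \<Longrightarrow> full_lab t q = Some (L q)"
proof -
  define L where "L q = (if q = [] then 2 * n - 1 else the (full_lab t q))" for q
  have n: "nleaves t = n" using card_leaf_labels[OF t(1)] t(2) by simp
  have t': "leaf_labels t = {1..nleaves t}" using t(2) n by simp
  note inv = full_lab_inv[OF t(1) t']
  note conjs = inv[unfolded lab_inv_def n]
  note dom = conjs[THEN conjunct2, THEN conjunct1, rule_format]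
  note leaf = conjs[THEN conjunct2, THEN conjunct2, THEN conjunct1, rule_format]
  note image = conjs[THEN conjunct2, THEN conjunct2, THEN conjunct2, THEN conjunct1]
  note child = conjs[THEN conjunct2, THEN conjunct2, THEN conjunct2, THEN conjunct2, THEN conjunct1,
      rule_format]
  note order = conjs[THEN conjunct2, THEN conjunct2, THEN conjunct2, THEN conjunct2, THEN conjunct2,
      rule_format]
  note inj = lab_inv_inj[OF inv t(1) t', unfolded n]
  have lab: "full_lab t q = Some (L q)" if "q \<in> positions t" "q \<noteq> []" for q
    using dom[of q] that unfolding L_def by auto
  have n1: "1 \<le> n" using card_inner[of t] n by simp
  have inner_n: "2 \<le> n" "[] \<in> inner t" "card (inner t - {[]}) = n - 2" if q: "q \<in> positions t" "q \<noteq> []" for q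
  proof -
    obtain l r where "t = Node l r" using q by (cases t) auto
    then show root: "[] \<in> inner t" by simp
    then have "card (inner t) \<noteq> 0" by auto
    then show "2 \<le> n" using card_inner[of t] n by linarith
    show "card (inner t - {[]}) = n - 2" using root card_inner[of t] n by simp
  qed
  have range: "1 \<le> L q \<and> L q \<le> 2 * n - 2" if "q \<in> positions t" "q \<noteq> []" for q
    using inj(1)[OF lab[OF that]] inner_n[OF that] by auto
  have L_Nil: "L [] = 2 * n - 1" by (simp add: L_def)
  have L_inj: "inj_on L (positions t)"
  proof (rule inj_onI)
    fix q q' assume *: "q \<in> positions t" "q' \<in> positions t" "L q = L q'"
    show "q = q'"
    proof (cases "q = [] \<or> q' = []")
      case True
      then show ?thesis using * range[of q] range[of q'] L_Nil n1 by fastforce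
    next
      case False
      then show ?thesis using lab * inj(2) by metis
    qed
  qed
  have "L ` positions t \<subseteq> {1..2*n-1}"
  proof
    fix v assume "v \<in> L ` positions t"
    then obtain q where "q \<in> positions t" "v = L q" by blast
    then show "v \<in> {1..2*n-1}" using range[of q] L_Nil n1 by (cases "q = []") auto
  qed
  moreover have "card (L ` positions t) = card {1..2*n-1}"
    using L_inj card_positions[of t] n by (simp add: card_image)
  ultimately have L_image: "L ` positions t = {1..2*n-1}" by (intro card_subset_eq) auto
  have L_child: "L (q @ [x]) < L q" if q: "q \<in> inner t" for q x
  proof (cases "q = []")
    case True
    have "q @ [x] \<in> positions t" using q by simp
    then show ?thesis using range[of "q @ [x]"] inner_n(1)[of "q @ [x]"] L_Nil True by auto
  next
    case False
    then show ?thesis using child[of q x] q by (simp add: L_def)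
  qed
  have "valid_lab n t L"
    unfolding valid_lab_def
  proof (intro conjI ballI allI impI)
    show "bij_betw L (positions t) {1..2*n-1}" using L_inj L_image by (simp add: bij_betw_def)
    show "L [] = 2 * n - 1" by (rule L_Nil)
    fix q assume q: "q \<in> positions t"
    fix a assume a: "subtree_at t q = Leaf a"
    have "a \<in> {1..n}" using leaf_labels_subtree_at[of t q] a t(2) by simp
    then show "a \<le> n" by simp
    show "L q = a"
    proof (cases "q = []")
      case True
      \<comment> \<open>The tree is a single leaf: then \<open>n = 1\<close>, and the root label
        \<open>2 * n - 1\<close> agrees with the leaf label 1.\<close>
      then have "{1..n} = {a}" using a t(2) by simp
      then have "a = 1 \<and> n = 1" using n1
        by (metis \<open>a \<in> {1..n}\<close> atLeastAtMost_iff le_refl singletonD)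
      then show ?thesis using L_Nil True by simp
    next
      case False
      then show ?thesis using leaf[OF q a] by (simp add: L_def)
    qed
  next
    fix q assume q: "q \<in> inner t"
    then have "q @ [True] \<in> positions t" by simp
    then have n2: "2 \<le> n" using inner_n by blast
    show "n < L q"
    proof (cases "q = []")
      case True
      then show ?thesis using L_Nil n2 by simp
    next
      case False
      then have "full_lab t q \<in> full_lab t ` (inner t - {[]})" using q by auto
      then show ?thesis unfolding image using False by (auto simp: L_def)
    qed
    show "L (q @ [x]) < L q" for x by (rule L_child[OF q])
  next
    fix q q' assume *: "q \<in> inner t" "q' \<in> inner t" "L q < L q'" "\<forall>x. L (q' @ [x]) < L q"
    have pos: "q \<in> positions t" "q' \<in> positions t" using *(1,2) inner_subset[of t] by auto
    have qNil: "q \<noteq> []" using *(3) range[of q'] pos L_Nil by (cases "q' = []") auto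
    note n2 = inner_n(1)[OF pos(1) qNil]
    \<comment> \<open>The procedure never compares with the root, and here the root cannot occur as
      \<open>q'\<close>: the label \<open>2 * n - 2\<close> sits on one of its children, because
      only the root has a larger label, so \<open>L q\<close> would have to exceed it.\<close>
    have q'Nil: "q' \<noteq> []"
    proof
      assume "q' = []"
      have "2 * n - 2 \<in> L ` positions t" using n2 unfolding L_image by auto
      then obtain r where r: "r \<in> positions t" "2 * n - 2 = L r" by blast
      then have "r \<noteq> []" using L_Nil n2 by (intro notI) simp
      then obtain r' x where r': "r = r' @ [x]" "r' \<in> inner t"
        using r(1) by (elim positions_snocE) auto
      then have "2 * n - 2 < L r'" using L_child r by metis
      moreover have "r' \<in> positions t" using r' inner_subset[of t] by auto
      ultimately have "r' = []" using range[of r'] by fastforce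
      then have "2 * n - 2 < L q" using *(4) r r' \<open>q' = []\<close> by auto
      then show False using range[OF pos(1) qNil] by simp
    qed
    have L_eq: "L (p @ [x]) = the (full_lab t (p @ [x]))" for p x by (simp add: L_def)
    have "min_child (the \<circ> full_lab t) q < min_child (the \<circ> full_lab t) q'"
    proof (rule order)
      show "q \<in> inner t - {[]}" "q' \<in> inner t - {[]}" using * qNil q'Nil by auto
      show "q' \<notin> inner t - {[]} \<or> the (full_lab t q) < the (full_lab t q')"
        using *(3) qNil q'Nil by (simp add: L_def)
      show "full_lab t (q' @ [x]) \<noteq> None \<and> the (full_lab t (q' @ [x])) < the (full_lab t q)" for x
        using *(2,4) lab[of "q' @ [x]"] qNil by (auto simp: L_def)
    qed
    then show "min_child L q < min_child L q'" by (simp only: min_child_def L_eq comp_def)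
  qed
  with lab that show thesis by blast
qed

section \<open>From labelled trees to matchings\<close>

definition siblings_paired :: "nat \<Rightarrow> ltree \<Rightarrow> (bool list \<Rightarrow> nat) \<Rightarrow> (nat \<Rightarrow> nat) \<Rightarrow> bool" where
  "siblings_paired n t L \<pi> \<longleftrightarrow> (\<forall>q\<in>inner t. \<forall>x. \<pi> (L (q @ [x])) = L (q @ [\<not> x])) \<and>
     (\<forall>i. i \<notin> {1..2*n-2} \<longrightarrow> \<pi> i = i)"

lemma siblings_pairedD:
  assumes "siblings_paired n t L \<pi>"
  shows "q \<in> inner t \<Longrightarrow> \<pi> (L (q @ [x])) = L (q @ [\<not> x])" "i \<notin> {1..2*n-2} \<Longrightarrow> \<pi> i = i"
  using assms unfolding siblings_paired_def by blast+

lemma valid_lab_nonroot_image: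
  assumes L: "valid_lab n t L" and "i \<in> {1..2*n-2}"
  obtains q x where "q \<in> inner t" "i = L (q @ [x])"
proof -
  have "i \<in> L ` positions t" using valid_labD(1)[OF L] assms(2) by (auto simp: bij_betw_def)
  then obtain r where r: "r \<in> positions t" "i = L r" by blast
  then have "r \<noteq> []" using valid_labD(2)[OF L] assms(2) by (intro notI) auto
  with r that show thesis by (elim positions_snocE) auto
qed

lemma valid_lab_child_range:
  assumes L: "valid_lab n t L" and q: "q \<in> inner t"
  shows "L (q @ [x]) \<in> {1..2*n-2}"
proof -
  have im: "L ` positions t = {1..2*n-1}" using valid_labD(1)[OF L] by (simp add: bij_betw_def)
  have "q @ [x] \<in> positions t" "q \<in> positions t" using q inner_subset[of t] by auto
  then have "L (q @ [x]) \<in> {1..2*n-1}" "L q \<in> {1..2*n-1}" using im by blast+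
  then show ?thesis using valid_labD(5)[OF L q, of x] by simp
qed

lemma valid_lab_inj:
  "valid_lab n t L \<Longrightarrow> q \<in> positions t \<Longrightarrow> q' \<in> positions t \<Longrightarrow> L q = L q' \<Longrightarrow> q = q'"
  using valid_labD(1) by (auto simp: bij_betw_def dest: inj_onD)

lemma siblings_paired_matching:
  assumes L: "valid_lab n t L" and \<pi>: "siblings_paired n t L \<pi>"
  shows "\<pi> \<in> matchings (2 * n - 2)"
  unfolding matchings_def mem_Collect_eq
proof (intro conjI ballI allI impI)
  fix i assume "i \<in> {1..2*n-2}"
  then obtain q x where q: "q \<in> inner t" "i = L (q @ [x])" by (rule valid_lab_nonroot_image[OF L])
  have \<pi>i: "\<pi> i = L (q @ [\<not> x])" using siblings_pairedD(1)[OF \<pi>] q by simp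
  then show "\<pi> i \<in> {1..2*n-2}" using valid_lab_child_range[OF L q(1)] by simp
  show "\<pi> (\<pi> i) = i" using \<pi>i siblings_pairedD(1)[OF \<pi> q(1), of "\<not> x"] q by simp
  show "\<pi> i \<noteq> i" using \<pi>i q valid_lab_inj[OF L, of "q @ [\<not> x]" "q @ [x]"] by auto
qed (rule siblings_pairedD(2)[OF \<pi>])

lemma Psi_siblings_paired:
  assumes L: "valid_lab n t L"
    and lab: "\<And>q. q \<in> positions t \<Longrightarrow> q \<noteq> [] \<Longrightarrow> full_lab t q = Some (L q)"
  shows "siblings_paired n t L (Psi t)"
  unfolding siblings_paired_def
proof (intro conjI ballI allI impI)
  fix q x assume q: "q \<in> inner t"
  have lab': "full_lab t (q @ [y]) = Some (L (q @ [y]))" for y using lab q by simp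
  have *: "(q' \<in> positions t \<and> q' \<noteq> [] \<and> full_lab t q' = Some (L (q @ [x]))) \<longleftrightarrow> q' = q @ [x]" for q'
    using lab valid_lab_inj[OF L, of q' "q @ [x]"] q by auto
  show "Psi t (L (q @ [x])) = L (q @ [\<not> x])"
    unfolding Psi_def * by (simp add: lab')
next
  fix i assume i: "i \<notin> {1..2*n-2}"
  have "full_lab t q \<noteq> Some i" if "q \<in> positions t" "q \<noteq> []" for q
    using lab[OF that] i that valid_lab_child_range[OF L] by (elim positions_snocE) auto
  then show "Psi t i = i" unfolding Psi_def by auto
qed

text \<open>\<open>m v\<close> is the smaller of the two labels on the children of the vertex labelled \<open>v\<close>; the other
  one is \<open>\<pi> (m v)\<close>.\<close>
locale merge_order =
  fixes n :: nat and \<pi> m :: "nat \<Rightarrow> nat"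
  assumes matching: "\<pi> \<in> matchings (2 * n - 2)"
    and m_less: "n < v \<Longrightarrow> v \<le> 2 * n - 1 \<Longrightarrow> 1 \<le> m v \<and> m v < \<pi> (m v) \<and> \<pi> (m v) < v"
    and m_inj: "inj_on m {n<..2*n-1}"
    and m_order: "n < v \<Longrightarrow> v < w \<Longrightarrow> w \<le> 2 * n - 1 \<Longrightarrow> \<pi> (m w) < v \<Longrightarrow> m v < m w"
    and m_cover: "i \<in> {1..2*n-2} \<Longrightarrow> \<exists>v\<in>{n<..2*n-1}. i = m v \<or> i = \<pi> (m v)"

section \<open>Uniqueness and existence of the merge order of a matching\<close>

lemma matchingsD:
  assumes "\<pi> \<in> matchings N"
  shows "i \<in> {1..N} \<Longrightarrow> \<pi> i \<in> {1..N}" "i \<in> {1..N} \<Longrightarrow> \<pi> i \<noteq> i" "\<pi> (\<pi> i) = i"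
    "i \<notin> {1..N} \<Longrightarrow> \<pi> i = i"
  using assms unfolding matchings_def by (cases "i \<in> {1..N}"; simp)+

text \<open>By symmetry, \<open>a v \<le> b v\<close> suffices when the two agree below
  \<open>v\<close>. The pair of \<open>b v\<close> is used by \<open>a\<close> at some
  \<open>w\<close>: not for \<open>w < v\<close>, since \<open>b\<close> would then use it twice,
  and if \<open>w > v\<close>, it was already available to \<open>a\<close> at
  \<open>v\<close>.\<close>

lemma merge_order_unique:
  assumes "merge_order n \<pi> m" "merge_order n \<pi> m'" "n < v" "v \<le> 2 * n - 1"
  shows "m v = m' v"
  using assms(3,4)
proof (induction v rule: less_induct)
  case (less v)
  have half: "a v < b v \<or> a v = b v"
    if a: "merge_order n \<pi> a" and b: "merge_order n \<pi> b"
      and IH: "\<And>w. w < v \<Longrightarrow> n < w \<Longrightarrow> w \<le> 2 * n - 1 \<Longrightarrow> a w = b w" for a b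
  proof -
    interpret a: merge_order n \<pi> a by fact
    interpret b: merge_order n \<pi> b by fact
    have bv: "1 \<le> b v" "b v < \<pi> (b v)" "\<pi> (b v) < v" using b.m_less less.prems by auto
    then have "b v \<in> {1..2*n-2}" using less.prems by auto
    then obtain w where w: "n < w" "w \<le> 2 * n - 1" "b v = a w \<or> b v = \<pi> (a w)"
      using a.m_cover[of "b v"] by auto
    have eq: "b v = a w"
    proof (rule ccontr)
      assume "b v \<noteq> a w"
      then have "b v = \<pi> (a w)" "\<pi> (b v) = a w" using w matchingsD(3)[OF a.matching] by auto
      then show False using bv a.m_less[OF w(1,2)] by simp
    qed
    have "\<not> w < v"
    proof
      assume "w < v"
      then have "b w = b v" using IH w eq by simp
      then show False using inj_onD[OF b.m_inj, of w v] w less.prems \<open>w < v\<close> by auto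
    qed
    then show ?thesis using a.m_order[of v w] eq bv w less.prems by (cases "v = w") auto
  qed
  show ?case
    using half[OF assms(1,2)] half[OF assms(2,1)] less.IH by fastforce
qed

function greedy :: "(nat \<Rightarrow> nat) \<Rightarrow> nat \<Rightarrow> nat \<Rightarrow> nat" where
  "greedy \<pi> n v = (LEAST a. 1 \<le> a \<and> a < \<pi> a \<and> \<pi> a < v \<and> (\<forall>w\<in>{n<..<v}. greedy \<pi> n w \<noteq> a))"
  by auto
termination by (relation "measure (\<lambda>(\<pi>, n, v). v)") auto

declare greedy.simps [simp del]

text \<open>Of the \<open>v - 1\<close> numbers below \<open>v\<close>, at most
  \<open>2 * n - 1 - v\<close> have a partner at or above \<open>v\<close>. The others form at least
  \<open>v - n\<close> whole pairs, while smaller vertices have used at most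
  \<open>v - n - 1\<close>. In total there are at most \<open>n - 1\<close> pairs and
  \<open>n - 1\<close> vertices choosing distinct ones, so in the end every pair is used.\<close>

lemma merge_order_exists:
  assumes \<pi>: "\<pi> \<in> matchings (2 * n - 2)"
  shows "merge_order n \<pi> (greedy \<pi> n)"
proof -
  note \<pi>D = matchingsD[OF \<pi>]
  let ?m = "greedy \<pi> n"
  define X where "X v = {a. 1 \<le> a \<and> a < \<pi> a \<and> \<pi> a < v}" for v
  have fin: "finite (X v)" for v
    by (rule finite_subset[of _ "{..<v}"]) (auto simp: X_def)
  have cardX: "v - n \<le> card (X v)" if v: "n < v" "v \<le> 2 * n - 1" for v
  proof -
    have "{1..<v} \<subseteq> (X v \<union> \<pi> ` X v) \<union> \<pi> ` {v..2*n-2}"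
    proof
      fix i assume i: "i \<in> {1..<v}"
      then have *: "i \<in> {1..2*n-2}" using v by auto
      note ** = \<pi>D(1,2)[OF *] \<pi>D(3)[of i]
      consider "v \<le> \<pi> i" | "\<pi> i < v" "i < \<pi> i" | "\<pi> i < v" "\<pi> i < i" using **(2) by linarith
      then show "i \<in> (X v \<union> \<pi> ` X v) \<union> \<pi> ` {v..2*n-2}"
      proof cases
        case 1
        then have "\<pi> i \<in> {v..2*n-2}" using **(1) by auto
        then show ?thesis using **(3) by (metis UnI2 imageI)
      next
        case 2
        then show ?thesis using i by (auto simp: X_def)
      next
        case 3
        then have "\<pi> i \<in> X v" using i ** by (auto simp: X_def)
        then show ?thesis using **(3) by (metis UnI1 UnI2 imageI)
      qed
    qed
    then have "card {1..<v} \<le> card ((X v \<union> \<pi> ` X v) \<union> \<pi> ` {v..2*n-2})"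
      using fin by (intro card_mono) auto
    also have "\<dots> \<le> (card (X v) + card (\<pi> ` X v)) + card (\<pi> ` {v..2*n-2})"
      using card_Un_le[of "X v \<union> \<pi> ` X v" "\<pi> ` {v..2*n-2}"] card_Un_le[of "X v" "\<pi> ` X v"] by simp
    also have "\<dots> \<le> (card (X v) + card (X v)) + card {v..2*n-2}"
      using fin by (intro add_mono card_image_le) auto
    finally show ?thesis using v by simp
  qed
  have cardX': "card (X (2*n-1)) \<le> n - 1"
  proof -
    have "X (2*n-1) \<inter> \<pi> ` X (2*n-1) = {}" using \<pi>D(3) by (auto simp: X_def)
    moreover have "inj_on \<pi> (X (2*n-1))" using \<pi>D(3) by (metis inj_onI)
    ultimately have "card (X (2*n-1)) + card (X (2*n-1)) = card (X (2*n-1) \<union> \<pi> ` X (2*n-1))"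
      using fin by (simp add: card_Un_disjoint card_image)
    also have "\<dots> \<le> card {1..2*n-2}"
      by (intro card_mono) (auto simp: X_def \<pi>D(3))
    finally show ?thesis by simp
  qed
  have m: "?m v \<in> X v \<and> (\<forall>w\<in>{n<..<v}. ?m w \<noteq> ?m v)"
    and least: "\<And>a. a \<in> X v \<Longrightarrow> (\<forall>w\<in>{n<..<v}. ?m w \<noteq> a) \<Longrightarrow> ?m v \<le> a"
    if v: "n < v" "v \<le> 2 * n - 1" for v
  proof -
    have "card (?m ` {n<..<v}) \<le> card {n<..<v}" by (rule card_image_le) simp
    then have "card (?m ` {n<..<v}) < card (X v)" using cardX[OF v] v by simp
    then have "\<not> X v \<subseteq> ?m ` {n<..<v}" using card_mono[of "?m ` {n<..<v}" "X v"] by auto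
    then obtain a where "1 \<le> a \<and> a < \<pi> a \<and> \<pi> a < v \<and> (\<forall>w\<in>{n<..<v}. ?m w \<noteq> a)"
      by (auto simp: X_def image_iff)
    from LeastI[of "\<lambda>a. 1 \<le> a \<and> a < \<pi> a \<and> \<pi> a < v \<and> (\<forall>w\<in>{n<..<v}. ?m w \<noteq> a)", OF this]
    show "?m v \<in> X v \<and> (\<forall>w\<in>{n<..<v}. ?m w \<noteq> ?m v)"
      unfolding greedy.simps[of \<pi> n v, symmetric] X_def by simp
    show "?m v \<le> a" if "a \<in> X v" "\<forall>w\<in>{n<..<v}. ?m w \<noteq> a" for a
      unfolding greedy.simps[of \<pi> n v] by (rule Least_le) (use that in \<open>auto simp: X_def\<close>)
  qed
  have inj: "inj_on ?m {n<..2*n-1}"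
  proof (rule linorder_inj_onI)
    fix v w assume "v < w" "v \<in> {n<..2*n-1}" "w \<in> {n<..2*n-1}"
    then show "?m v \<noteq> ?m w" using m[of w] by auto
  qed auto
  have "?m ` {n<..2*n-1} \<subseteq> X (2*n-1)"
  proof
    fix a assume "a \<in> ?m ` {n<..2*n-1}"
    then obtain v where "a = ?m v" "n < v" "v \<le> 2 * n - 1" by auto
    then show "a \<in> X (2*n-1)" using m[of v] by (auto simp: X_def)
  qed
  moreover have "card (?m ` {n<..2*n-1}) = n - 1" using inj by (simp add: card_image)
  ultimately have image: "?m ` {n<..2*n-1} = X (2*n-1)"
    using cardX' fin by (intro card_seteq) auto
  show ?thesis
  proof
    fix i assume i: "i \<in> {1..2*n-2}"
    note ** = \<pi>D(1,2)[OF i] \<pi>D(3)[of i]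
    then have "i \<in> X (2*n-1) \<or> \<pi> i \<in> X (2*n-1)" using i by (auto simp: X_def)
    then consider v where "v \<in> {n<..2*n-1}" "i = ?m v" | v where "v \<in> {n<..2*n-1}" "\<pi> i = ?m v"
      unfolding image[symmetric] by blast
    then show "\<exists>v\<in>{n<..2*n-1}. i = ?m v \<or> i = \<pi> (?m v)" using **(3) by cases metis+
  next
    fix v w assume *: "n < v" "v < w" "w \<le> 2 * n - 1" "\<pi> (?m w) < v"
    then have "?m w \<in> X v" "\<forall>u\<in>{n<..<v}. ?m u \<noteq> ?m w" using m[of w] by (auto simp: X_def)
    then have "?m v \<le> ?m w" using least * by simp
    moreover have "?m v \<noteq> ?m w" using m[of w] * by auto
    ultimately show "?m v < ?m w" by simp
  qed (use \<pi> inj m in \<open>auto simp: X_def\<close>)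
qed

section \<open>The merge order of a labelled tree\<close>

lemma min_childE:
  assumes L: "valid_lab n t L" and \<pi>: "siblings_paired n t L \<pi>" and q: "q \<in> inner t"
  obtains x where "min_child L q = L (q @ [x])" "\<pi> (min_child L q) = L (q @ [\<not> x])"
    "L (q @ [x]) < L (q @ [\<not> x])"
proof -
  have "L (q @ [False]) \<noteq> L (q @ [True])"
    using valid_lab_inj[OF L, of "q @ [False]" "q @ [True]"] q by auto
  then obtain x where x: "L (q @ [x]) < L (q @ [\<not> x])"
    by (metis (full_types) linorder_neqE_nat)
  then have "min_child L q = L (q @ [x])" unfolding min_child_def by (cases x) auto
  then show thesis using that x siblings_pairedD(1)[OF \<pi> q] by simp
qed

lemma valid_lab_inner_position:
  assumes L: "valid_lab n t L" and v: "n < v" "v \<le> 2 * n - 1"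
  obtains q where "q \<in> inner t" "L q = v" "inv_into (positions t) L v = q"
proof -
  have "v \<in> L ` positions t" using valid_labD(1)[OF L] v by (auto simp: bij_betw_def)
  then obtain q where q: "q \<in> positions t" "v = L q" by blast
  moreover have "q \<in> inner t"
    using not_inner_iff[OF q(1)] valid_labD(3)[OF L q(1)] v q by fastforce
  moreover have "inv_into (positions t) L v = q"
    using valid_labD(1)[OF L] q by (auto simp: bij_betw_def)
  ultimately show thesis using that by simp
qed

text \<open>\<open>inv_into\<close> finds the vertex with a given label, and the axioms are those of
  \<open>valid_lab\<close> read through it. Injectivity holds because a child determines its parent,
  covering because every non-root vertex is a child.\<close>

lemma valid_lab_merge_order:
  assumes L: "valid_lab n t L" and \<pi>: "siblings_paired n t L \<pi>"
  shows "merge_order n \<pi> (\<lambda>v. min_child L (inv_into (positions t) L v))"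
    (is "merge_order n \<pi> ?m")
proof
  show "\<pi> \<in> matchings (2 * n - 2)" by (rule siblings_paired_matching[OF L \<pi>])
next
  fix v assume "n < v" "v \<le> 2 * n - 1"
  then obtain q where q: "q \<in> inner t" "L q = v" "inv_into (positions t) L v = q"
    by (rule valid_lab_inner_position[OF L])
  obtain x where x: "min_child L q = L (q @ [x])" "\<pi> (min_child L q) = L (q @ [\<not> x])"
    "L (q @ [x]) < L (q @ [\<not> x])" by (rule min_childE[OF L \<pi> q(1)])
  then show "1 \<le> ?m v \<and> ?m v < \<pi> (?m v) \<and> \<pi> (?m v) < v"
    using valid_lab_child_range[OF L q(1)] valid_labD(5)[OF L q(1)] q by auto
next
  show "inj_on ?m {n<..2*n-1}"
  proof (rule inj_onI)
    fix v w assume *: "v \<in> {n<..2*n-1}" "w \<in> {n<..2*n-1}" "?m v = ?m w"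
    obtain q where q: "q \<in> inner t" "L q = v" "inv_into (positions t) L v = q"
      by (rule valid_lab_inner_position[OF L, of v]) (use * in auto)
    obtain r where r: "r \<in> inner t" "L r = w" "inv_into (positions t) L w = r"
      by (rule valid_lab_inner_position[OF L, of w]) (use * in auto)
    obtain x where x: "min_child L q = L (q @ [x])" by (rule min_childE[OF L \<pi> q(1)])
    obtain y where y: "min_child L r = L (r @ [y])" by (rule min_childE[OF L \<pi> r(1)])
    have "L (q @ [x]) = L (r @ [y])" using * x y q r by simp
    then have "q = r" using valid_lab_inj[OF L, of "q @ [x]" "r @ [y]"] q(1) r(1) by simp
    then show "v = w" using q r by simp
  qed
next
  fix v w assume *: "n < v" "v < w" "w \<le> 2 * n - 1" "\<pi> (?m w) < v"
  obtain q where q: "q \<in> inner t" "L q = v" "inv_into (positions t) L v = q"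
    by (rule valid_lab_inner_position[OF L, of v]) (use * in auto)
  obtain r where r: "r \<in> inner t" "L r = w" "inv_into (positions t) L w = r"
    by (rule valid_lab_inner_position[OF L, of w]) (use * in auto)
  obtain y where y: "min_child L r = L (r @ [y])" "\<pi> (min_child L r) = L (r @ [\<not> y])"
    "L (r @ [y]) < L (r @ [\<not> y])" by (rule min_childE[OF L \<pi> r(1)])
  have "L (r @ [x]) < L q" for x using y * q r by (cases "x = y") auto
  then have "min_child L q < min_child L r" using valid_labD(6)[OF L q(1) r(1)] * q r by simp
  then show "?m v < ?m w" using q r by simp
next
  fix i assume "i \<in> {1..2*n-2}"
  then obtain q x where q: "q \<in> inner t" "i = L (q @ [x])" by (rule valid_lab_nonroot_image[OF L])
  obtain y where y: "min_child L q = L (q @ [y])" "\<pi> (min_child L q) = L (q @ [\<not> y])"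
    by (rule min_childE[OF L \<pi> q(1)])
  have pos: "q \<in> positions t" using q inner_subset[of t] by auto
  have "L q \<in> {1..2*n-1}" using valid_labD(1)[OF L] pos by (auto simp: bij_betw_def)
  then have "L q \<in> {n<..2*n-1}" using valid_labD(4)[OF L q(1)] by simp
  moreover have "inv_into (positions t) L (L q) = q"
    using valid_labD(1)[OF L] pos by (simp add: bij_betw_def)
  moreover have "i = min_child L q \<or> i = \<pi> (min_child L q)" using q y by (cases "x = y") auto
  ultimately show "\<exists>v\<in>{n<..2*n-1}. i = ?m v \<or> i = \<pi> (?m v)" by (intro bexI[of _ "L q"]) auto
qed

section \<open>The tree encoded by a matching\<close>

context merge_order
begin

text \<open>\<open>rep t v\<close>: up to the order of children, \<open>t\<close> hangs below the vertex labelled \<open>v\<close> in the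
  tree encoded by \<open>\<pi>\<close>.\<close>
fun rep :: "ltree \<Rightarrow> nat \<Rightarrow> bool" where
  "rep (Leaf a) v \<longleftrightarrow> v = a \<and> 1 \<le> a \<and> a \<le> n"
| "rep (Node l r) v \<longleftrightarrow> n < v \<and> v \<le> 2 * n - 1 \<and>
     (rep l (m v) \<and> rep r (\<pi> (m v)) \<or> rep l (\<pi> (m v)) \<and> rep r (m v))"

text \<open>By induction the labels of the two children are determined. They form the pair attached
  to \<open>v\<close>, and its smaller member determines \<open>v\<close> by
  \<open>m_inj\<close>.\<close>

lemma rep_unique: "rep t v \<Longrightarrow> rep t w \<Longrightarrow> v = w"
proof (induction t arbitrary: v w)
  case (Node l r)
  have v: "n < v" "v \<le> 2 * n - 1" and w: "n < w" "w \<le> 2 * n - 1" using Node.prems by auto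
  have "{m v, \<pi> (m v)} = {m w, \<pi> (m w)}" using Node by auto
  then have "m v = m w" using m_less[OF v] m_less[OF w] by (auto simp: doubleton_eq_iff)
  then show ?case using inj_onD[OF m_inj] v w by auto
qed auto

lemma rep_cong_sim: "sim t t' \<Longrightarrow> rep t v \<Longrightarrow> rep t' v"
  by (induction arbitrary: v rule: sim.induct) auto

lemma rep_imp_sim: "rep t v \<Longrightarrow> rep t' v \<Longrightarrow> sim t t'"
proof (induction t arbitrary: t' v)
  case (Leaf a)
  then show ?case by (cases t') (auto intro: sim.intros)
next
  case (Node l r)
  then obtain l' r' where "t' = Node l' r'" by (cases t') auto
  with Node show ?case by (auto intro: sim.intros)
qed

lemma rep_exists: "1 \<le> v \<Longrightarrow> v \<le> 2 * n - 1 \<Longrightarrow> \<exists>t. rep t v"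
proof (induction v rule: less_induct)
  case (less v)
  show ?case
  proof (cases "v \<le> n")
    case True
    then have "rep (Leaf v) v" using less by simp
    then show ?thesis by blast
  next
    case False
    then have "1 \<le> m v \<and> m v < \<pi> (m v) \<and> \<pi> (m v) < v" using m_less less.prems by simp
    then obtain l r where "rep l (m v)" "rep r (\<pi> (m v))"
      using less.IH[of "m v"] less.IH[of "\<pi> (m v)"] less.prems by auto
    then have "rep (Node l r) v" using False less.prems by simp
    then show ?thesis by blast
  qed
qed

lemma rep_subtree: "rep t v \<Longrightarrow> q \<in> positions t \<Longrightarrow> \<exists>w. rep (subtree_at t q) w"
proof (induction t arbitrary: v q)
  case (Node l r)
  then show ?case by (cases q) (auto split: if_splits)
qed auto

definition vertex_label :: "ltree \<Rightarrow> nat" where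
  "vertex_label t = (THE v. rep t v)"

lemma vertex_label_eq: "rep t v \<Longrightarrow> vertex_label t = v"
  unfolding vertex_label_def using rep_unique by blast

text \<open>No number occurs twice, because vertices with equal labels have parents with equal
  labels, and so on up to the root. Every number occurs, because below \<open>2 * n - 1\<close> it
  belongs to the pair of a larger one.\<close>

lemma rep_labelling:
  assumes t: "rep t (2 * n - 1)" and n1: "1 \<le> n"
  defines "L \<equiv> \<lambda>q. vertex_label (subtree_at t q)"
  shows "valid_lab n t L" "siblings_paired n t L \<pi>" "distinct_leaves t" "leaf_labels t = {1..n}"
    "\<And>q. q \<in> positions t \<Longrightarrow> rep (subtree_at t q) (L q)"
proof -
  have rep_L: "rep (subtree_at t q) (L q)" if "q \<in> positions t" for q
    using rep_subtree[OF t that] vertex_label_eq unfolding L_def by auto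
  have L_Nil: "L [] = 2 * n - 1" unfolding L_def using vertex_label_eq t by simp
  have ch: "n < L q \<and> L q \<le> 2 * n - 1 \<and>
      (\<exists>x. L (q @ [x]) = m (L q) \<and> L (q @ [\<not> x]) = \<pi> (m (L q)))" if q: "q \<in> inner t" for q
  proof -
    obtain l r where lr: "subtree_at t q = Node l r" "q \<in> positions t"
      using q by (auto simp: inner_def)
    then have "rep (Node l r) (L q)" using rep_L by metis
    moreover have "subtree_at t (q @ [False]) = l" "subtree_at t (q @ [True]) = r"
      using subtree_at_snoc[OF lr(1)] by auto
    then have "\<And>v. rep l v \<Longrightarrow> L (q @ [False]) = v" "\<And>v. rep r v \<Longrightarrow> L (q @ [True]) = v"
      unfolding L_def using vertex_label_eq by auto
    ultimately show ?thesis by (auto simp: ex_bool_eq)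
  qed
  have ch_less: "L (q @ [x]) < L q" "1 \<le> L (q @ [x])" "min_child L q = m (L q)"
    "\<pi> (L (q @ [x])) = L (q @ [\<not> x])" "L (q @ [x]) \<noteq> L (q @ [\<not> x])" if q: "q \<in> inner t" for q x
  proof -
    obtain y where y: "n < L q" "L q \<le> 2 * n - 1" "L (q @ [y]) = m (L q)" "L (q @ [\<not> y]) = \<pi> (m (L q))"
      using ch[OF q] by blast
    note less = m_less[OF y(1,2)]
    show "L (q @ [x]) < L q" "1 \<le> L (q @ [x])" "L (q @ [x]) \<noteq> L (q @ [\<not> x])"
      using y less by (cases "x = y"; auto)+
    show "\<pi> (L (q @ [x])) = L (q @ [\<not> x])"
      using y matchingsD(3)[OF matching] by (cases "x = y") auto
    show "min_child L q = m (L q)"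
      unfolding min_child_def using y less by (cases y) auto
  qed
  have range: "1 \<le> L q \<and> L q \<le> 2 * n - 1" if q: "q \<in> positions t" for q
  proof (cases "q = []")
    case False
    obtain r x where rx: "q = r @ [x]" "r \<in> inner t" by (rule positions_snocE[OF q False])
    have "L r \<le> 2 * n - 1" using ch[OF rx(2)] by blast
    then show ?thesis using ch_less(1,2)[OF rx(2), of x] rx(1) by simp
  qed (use L_Nil n1 in auto)
  have L_inj: "q \<in> positions t \<Longrightarrow> q' \<in> positions t \<Longrightarrow> L q = L q' \<Longrightarrow> q = q'" for q q'
  proof (induction q arbitrary: q' rule: rev_induct)
    case Nil
    show ?case
    proof (rule ccontr)
      assume "[] \<noteq> q'"
      then obtain r x where rx: "q' = r @ [x]" "r \<in> inner t"
        using Nil.prems(2) by (elim positions_snocE) auto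
      then have "L q' < L r" "L r \<le> 2 * n - 1" using ch_less(1)[OF rx(2)] ch[OF rx(2)] by auto
      then show False using Nil.prems(3) L_Nil by simp
    qed
  next
    case (snoc x r)
    have r: "r \<in> inner t" "r \<in> positions t" using snoc.prems(1) inner_subset[of t] by auto
    have "q' \<noteq> []" using snoc.prems L_Nil ch_less(1)[OF r(1), of x] range[OF r(2)] by auto
    then obtain r' x' where q': "q' = r' @ [x']" "r' \<in> inner t"
      using snoc.prems(2) by (elim positions_snocE) auto
    have r': "r' \<in> positions t" using q' inner_subset[of t] by auto
    \<comment> \<open>The two pairs share a number and \<pi> is an involution, so they are the same
      pair; \<open>m\<close> selects its smaller end.\<close>
    have "m (L r) = m (L r')"
    proof -
      obtain y where y: "L (r @ [y]) = m (L r)" "L (r @ [\<not> y]) = \<pi> (m (L r))" using ch[OF r(1)]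
        by blast
      obtain y' where y': "L (r' @ [y']) = m (L r')" "L (r' @ [\<not> y']) = \<pi> (m (L r'))"
        using ch[OF q'(2)] by blast
      have less: "m (L r) < \<pi> (m (L r))" "m (L r') < \<pi> (m (L r'))"
        using m_less ch[OF r(1)] ch[OF q'(2)] by auto
      have "L (r @ [x]) \<in> {m (L r), \<pi> (m (L r))}" using y by (cases "x = y") auto
      moreover have "L (r' @ [x']) \<in> {m (L r'), \<pi> (m (L r'))}" using y' by (cases "x' = y'") auto
      moreover have "L (r @ [x]) = L (r' @ [x'])" using snoc.prems(3) q'(1) by simp
      ultimately consider "m (L r) = m (L r')" | "m (L r) = \<pi> (m (L r'))" | "\<pi> (m (L r)) = m (L r')"
        | "\<pi> (m (L r)) = \<pi> (m (L r'))" by (metis insert_iff singletonD)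
      moreover have inv: "\<pi> (\<pi> i) = i" for i by (rule matchingsD(3)[OF matching])
      ultimately show ?thesis
      proof cases
        case 2
        then have "\<pi> (m (L r)) = m (L r')" using inv by metis
        with 2 less show ?thesis by simp
      next
        case 3
        then have "m (L r) = \<pi> (m (L r'))" using inv by metis
        with 3 less show ?thesis by simp
      next
        case 4
        then show ?thesis using inv by metis
      qed simp
    qed
    then have "L r = L r'" using inj_onD[OF m_inj] ch[OF r(1)] ch[OF q'(2)] by auto
    then have "r = r'" using snoc.IH r r' by blast
    moreover have "x = x'"
      using ch_less(5)[OF r(1), of x] snoc.prems(3) q' \<open>r = r'\<close> by (cases "x = x'") auto
    ultimately show ?case using q' by simp
  qed
  have L_surj: "v \<in> L ` positions t" if "1 \<le> v" "v \<le> 2 * n - 1" for v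
    using that
  \<comment> \<open>Induction downwards from the root label: \<open>v\<close> is in the pair of some
    \<open>w > v\<close>, so it labels a child of the vertex labelled \<open>w\<close>.\<close>
  proof (induction "2 * n - 1 - v" arbitrary: v rule: less_induct)
    case less
    show ?case
    proof (cases "v = 2 * n - 1")
      case True
      then show ?thesis using L_Nil by (metis Nil_in_positions imageI)
    next
      case False
      then have "v \<in> {1..2*n-2}" using less.prems by auto
      then obtain w where w: "n < w" "w \<le> 2 * n - 1" "v = m w \<or> v = \<pi> (m w)" using m_cover by force
      then have "v < w" using m_less by fastforce
      then have "w \<in> L ` positions t" using less.hyps[of w] w by auto
      then obtain q where q: "q \<in> positions t" "w = L q" by blast
      have "q \<in> inner t"
      proof (rule ccontr)
        assume "q \<notin> inner t"
        then obtain a where "subtree_at t q = Leaf a" using not_inner_iff[OF q(1)] by blast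
        then show False using rep_L[OF q(1)] q w by simp
      qed
      then obtain x where "L (q @ [x]) = v" "q @ [x] \<in> positions t"
        using ch[of q] w q by auto
      then show ?thesis by blast
    qed
  qed
  have bij: "bij_betw L (positions t) {1..2*n-1}"
    unfolding bij_betw_def using L_inj L_surj range by (auto simp: inj_on_def)
  have leaf: "L q = a \<and> 1 \<le> a \<and> a \<le> n" if "q \<in> positions t" "subtree_at t q = Leaf a" for q a
    using rep_L[OF that(1)] that(2) by simp
  show "valid_lab n t L"
    unfolding valid_lab_def
  proof (intro conjI ballI allI impI)
    fix q q' assume *: "q \<in> inner t" "q' \<in> inner t" "L q < L q'" "\<forall>x. L (q' @ [x]) < L q"
    then have "\<pi> (m (L q')) < L q" using ch[OF *(2)] by metis
    then show "min_child L q < min_child L q'"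
      using m_order[of "L q" "L q'"] ch[OF *(1)] ch[OF *(2)] *(3) ch_less(3) *(1,2) by simp
  qed (use bij L_Nil leaf ch ch_less(1) in auto)
  show "siblings_paired n t L \<pi>"
    unfolding siblings_paired_def using ch_less(4) matchingsD(4)[OF matching] by blast
  show "distinct_leaves t"
    by (rule distinct_leavesI) (metis leaf L_inj)
  show "leaf_labels t = {1..n}"
  proof (intro equalityI subsetI)
    fix a assume "a \<in> leaf_labels t"
    then show "a \<in> {1..n}" using leaf_position_exists leaf by fastforce
  next
    fix a assume a: "a \<in> {1..n}"
    then have "a \<in> L ` positions t" using L_surj by auto
    then obtain q where q: "q \<in> positions t" "a = L q" by blast
    then have "rep (subtree_at t q) a" using rep_L by simp
    then have "subtree_at t q = Leaf a" using a by (cases "subtree_at t q") auto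
    then show "a \<in> leaf_labels t" using leaf_labels_subtree_at[of t q] by simp
  qed
  show "\<And>q. q \<in> positions t \<Longrightarrow> rep (subtree_at t q) (L q)" by (rule rep_L)
qed

text \<open>Converse of \<open>rep_labelling\<close>. The labelling \<open>L\<close> has a merge
  order of its own, which \<open>merge_order_unique\<close> identifies with the \<open>m\<close> of
  the locale; hence \<open>m (L q)\<close> sits on a child of \<open>q\<close>.\<close>

lemma valid_lab_rep:
  assumes L: "valid_lab n t L" and \<pi>: "siblings_paired n t L \<pi>" and "q \<in> positions t"
  shows "rep (subtree_at t q) (L q)"
  using assms(3)
proof (induction "subtree_at t q" arbitrary: q)
  case (Leaf a)
  have "L q \<in> {1..2*n-1}" using valid_labD(1)[OF L] Leaf.prems by (auto simp: bij_betw_def)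
  then show ?case using valid_labD(3)[OF L Leaf.prems Leaf.hyps[symmetric]] Leaf.hyps
    by (metis atLeastAtMost_iff rep.simps(1))
next
  case (Node l r)
  have q: "q \<in> inner t" using Node by (auto simp: inner_def intro: sym)
  have Lq: "n < L q" "L q \<le> 2 * n - 1"
    using valid_labD(1)[OF L] Node.prems valid_labD(4)[OF L q] by (auto simp: bij_betw_def)
  have "m (L q) = min_child L (inv_into (positions t) L (L q))"
    using merge_order_unique[OF merge_order_axioms valid_lab_merge_order[OF L \<pi>] Lq] .
  also have "inv_into (positions t) L (L q) = q"
    using valid_labD(1)[OF L] Node.prems by (simp add: bij_betw_def)
  finally have m: "m (L q) = min_child L q" .
  have sub: "subtree_at t (q @ [False]) = l" "subtree_at t (q @ [True]) = r"
    using subtree_at_snoc[OF Node.hyps(3)[symmetric]] by auto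
  have "rep l (L (q @ [False]))" "rep r (L (q @ [True]))"
    using Node.hyps(1)[of "q @ [False]"] Node.hyps(2)[of "q @ [True]"] sub q by auto
  moreover obtain x where "min_child L q = L (q @ [x])" "\<pi> (min_child L q) = L (q @ [\<not> x])"
    by (rule min_childE[OF L \<pi> q])
  ultimately have "rep (Node l r) (L q)" using Lq m by (cases x) auto
  then show ?case using Node.hyps(3) by simp
qed

end

section \<open>The bijections\<close>

text \<open>Subtrees at positions that branch apart have disjoint nonempty leaf sets; of two nested
  ones, the outer has additional leaves. This turns a leaf set back into a mark.\<close>

lemma subtree_at_inj:
  "distinct_leaves t \<Longrightarrow> q \<in> positions t \<Longrightarrow> q' \<in> positions t \<Longrightarrow>
    leaf_labels (subtree_at t q) = leaf_labels (subtree_at t q') \<Longrightarrow> q = q'"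
proof (induction t arbitrary: q q')
  case (Node l r)
  show ?case
  proof (cases "q = [] \<or> q' = []")
    case True
    then show ?thesis
      using subtree_at_whole_iff[OF Node.prems(1,2)] subtree_at_whole_iff[OF Node.prems(1,3)]
        Node.prems(4) by (metis subtree_at.simps(1))
  next
    case False
    then obtain b p b' p' where qq: "q = b # p" "q' = b' # p'" by (cases q; cases q') auto
    have "b = b'"
    proof (rule ccontr)
      assume "b \<noteq> b'"
      then have "leaf_labels (subtree_at (Node l r) q) \<subseteq> leaf_labels l \<inter> leaf_labels r"
        using Node.prems(4) leaf_labels_subtree_at[of l p] leaf_labels_subtree_at[of r p]
          leaf_labels_subtree_at[of l p'] leaf_labels_subtree_at[of r p'] unfolding qq
        by (cases b; cases b') auto
      then show False using Node.prems(1) leaf_labels_nonempty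
        by (metis distinct_leaves.simps(2) subset_empty)
    qed
    then show ?thesis using Node.prems Node.IH[of p p'] unfolding qq by (cases b) auto
  qed
qed simp

context merge_order
begin

text \<open>From right to left, the labelling read off from \<pi> and the one computed by the
  procedure are both valid, hence equal, so the two matchings pair the same siblings.\<close>

lemma Psi_eq_iff_rep:
  assumes t: "distinct_leaves t" "leaf_labels t = {1..n}"
  shows "Psi t = \<pi> \<longleftrightarrow> rep t (2 * n - 1)"
proof -
  obtain L where L: "valid_lab n t L"
    and lab: "\<And>q. q \<in> positions t \<Longrightarrow> q \<noteq> [] \<Longrightarrow> full_lab t q = Some (L q)"
    using full_lab_valid[OF t] by blast
  have paired: "siblings_paired n t L (Psi t)" by (rule Psi_siblings_paired[OF L lab])
  have n1: "1 \<le> n" using leaf_labels_nonempty[of t] unfolding t(2) by simp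
  show ?thesis
  proof
    assume "Psi t = \<pi>"
    then show "rep t (2 * n - 1)"
      using valid_lab_rep[OF L, of "[]"] paired valid_labD(2)[OF L] by simp
  next
    assume rep: "rep t (2 * n - 1)"
    let ?L = "\<lambda>q. vertex_label (subtree_at t q)"
    have L': "valid_lab n t ?L" and paired': "siblings_paired n t ?L \<pi>"
      using rep_labelling[OF rep n1] by auto
    have eq: "L (q @ [x]) = ?L (q @ [x])" if "q \<in> inner t" for q x
      using valid_lab_unique[OF L L', of "q @ [x]"] that by simp
    show "Psi t = \<pi>"
    proof
      fix i show "Psi t i = \<pi> i"
      proof (cases "i \<in> {1..2*n-2}")
        case False
        then show ?thesis
          using siblings_pairedD(2)[OF paired] siblings_pairedD(2)[OF paired'] by metis
      next
        case True
        then obtain q x where q: "q \<in> inner t" "i = L (q @ [x])"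
          by (rule valid_lab_nonroot_image[OF L])
        then have "i = ?L (q @ [x])" using eq by simp
        then have "\<pi> i = ?L (q @ [\<not> x])" using siblings_pairedD(1)[OF paired' q(1)] by metis
        then show ?thesis using siblings_pairedD(1)[OF paired q(1)] q eq by simp
      qed
    qed
  qed
qed

end

lemma sum_take_nonneg_iff:
  "(\<forall>j. 1 \<le> j \<and> j \<le> N \<longrightarrow> 0 \<le> sum_list (take j p)) \<longleftrightarrow>
    (\<forall>j\<le>N. 0 \<le> sum_list (take j (p :: int list)))"
proof (intro iffI allI impI)
  fix j assume "\<forall>j. 1 \<le> j \<and> j \<le> N \<longrightarrow> 0 \<le> sum_list (take j p)" "j \<le> N"
  then show "0 \<le> sum_list (take j p)" by (cases "j = 0") auto
qed auto

lemma motzkin_paths_iff: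
  assumes "2 \<le> n"
  shows "(p, s) \<in> motzkin_paths n \<longleftrightarrow> motzkin p s \<and> set s = {1..n}"
proof -
  have "length s = n" if "distinct s" "set s = {1..n}" using that
    by (metis card_atLeastAtMost diff_Suc_1 distinct_card)
  moreover have "j < length p \<longleftrightarrow> j \<le> n - 2" if "length p = n - 1" for j
    using that assms by auto
  ultimately show ?thesis
    unfolding motzkin_paths_def well_labelled_def motzkin_def labelled_path_iff sum_take_nonneg_iff
    using assms by (auto simp: Suc_diff_Suc)
qed

lemma positive_paths_iff:
  assumes "1 \<le> n"
  shows "(p, s) \<in> positive_paths n \<longleftrightarrow> positive p s \<and> set s = {1..n}"
proof -
  have "length s = n" if "distinct s" "set s = {1..n}" using that
    by (metis card_atLeastAtMost diff_Suc_1 distinct_card)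
  then show ?thesis
    unfolding positive_paths_def well_labelled_def positive_def labelled_path_iff sum_take_nonneg_iff
    using assms by (auto simp: Suc_diff_Suc)
qed

lemma length_distinct_upto: "distinct s \<Longrightarrow> set s = {1..n} \<Longrightarrow> set s = {1..length s}"
  by (metis card_atLeastAtMost diff_Suc_1 distinct_card)

lemma Phi_phi_graph:
  assumes "2 \<le> n" "(p, s) \<in> motzkin_paths n"
  shows "phi_graph p s (Phi (p, s))" "leaf_labels (Phi (p, s)) = {1..n}" "distinct_leaves (Phi (p, s))"
proof -
  have m: "motzkin p s" "set s = {1..n}" using assms motzkin_paths_iff by auto
  then obtain t where t: "phi_graph p s t" using motzkin_imp_phi_graph by blast
  have "set s = {1..length s}" using m length_distinct_upto by (auto simp: motzkin_def)
  then have "Phi (p, s) = t" using phi_aux_eq[OF t] by (simp add: Phi_def)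
  then show "phi_graph p s (Phi (p, s))" "leaf_labels (Phi (p, s)) = {1..n}" "distinct_leaves (Phi (p, s))"
    using t phi_graph_motzkin[OF t] m by auto
qed

lemma Phi'_phi'_graph:
  assumes "1 \<le> n" "(p, s) \<in> positive_paths n"
  obtains t q where "Phi' (p, s) = (t, q)" "phi'_graph p s t q" "leaf_labels t = {1..n}"
    "distinct_leaves t" "q \<in> positions t"
proof -
  have m: "positive p s" "set s = {1..n}" using assms positive_paths_iff by auto
  then obtain t q where t: "phi'_graph p s t q" using positive_imp_phi'_graph by blast
  have "set s = {1..length s}" using m length_distinct_upto by (auto simp: positive_def)
  then have "Phi' (p, s) = (t, q)" using phi'_aux_eq[OF t] by (simp add: Phi'_def)
  then show thesis using that t phi'_graph_positive[OF t] m by auto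
qed

lemma Psi_matching:
  assumes "distinct_leaves t" "leaf_labels t = {1..n}"
  shows "Psi t \<in> matchings (2 * n - 2)"
  using full_lab_valid[OF assms] Psi_siblings_paired siblings_paired_matching by metis

lemma Psi_Phi_bij:
  assumes n: "2 \<le> n"
  shows "bij_betw (Psi \<circ> Phi) (motzkin_paths n) (matchings (2 * n - 2))"
  unfolding bij_betw_def
proof (intro conjI inj_onI equalityI subsetI)
  fix x y assume xy: "x \<in> motzkin_paths n" "y \<in> motzkin_paths n" "(Psi \<circ> Phi) x = (Psi \<circ> Phi) y"
  obtain p s p' s' where x: "x = (p, s)" and y: "y = (p', s')" by (cases x, cases y)
  note fx = Phi_phi_graph[OF n xy(1)[unfolded x]] and fy = Phi_phi_graph[OF n xy(2)[unfolded y]]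
  define \<pi> where "\<pi> = Psi (Phi x)"
  interpret merge_order n \<pi> "greedy \<pi> n"
    unfolding \<pi>_def x by (rule merge_order_exists[OF Psi_matching[OF fx(3,2)]])
  \<comment> \<open>Both trees hang below the root label of the same \<pi>, so they differ only in
    the order of children.\<close>
  have "rep (Phi x) (2 * n - 1)" "rep (Phi y) (2 * n - 1)"
    using Psi_eq_iff_rep[OF fx(3,2)] Psi_eq_iff_rep[OF fy(3,2)] xy(3) unfolding \<pi>_def x y by auto
  then have "sim (Phi x) (Phi y)" by (rule rep_imp_sim)
  then show "x = y" using phi_graph_inj[OF fx(1) fy(1)] unfolding x y by simp
next
  fix \<pi> assume "\<pi> \<in> (Psi \<circ> Phi) ` motzkin_paths n"
  then obtain p s where ps: "(p, s) \<in> motzkin_paths n" "\<pi> = Psi (Phi (p, s))" by auto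
  show "\<pi> \<in> matchings (2 * n - 2)"
    unfolding ps(2) using Phi_phi_graph[OF n ps(1)] by (intro Psi_matching)
next
  fix \<pi> assume \<pi>: "\<pi> \<in> matchings (2 * n - 2)"
  interpret merge_order n \<pi> "greedy \<pi> n" by (rule merge_order_exists[OF \<pi>])
  obtain t where t: "rep t (2 * n - 1)" using rep_exists[of "2 * n - 1"] n by fastforce
  have t': "distinct_leaves t" "leaf_labels t = {1..n}" using rep_labelling[OF t] n by auto
  \<comment> \<open>A leaf represents a label of at most \<open>n\<close>, and for
    \<open>n \<ge> 2\<close> the root label is larger.\<close>
  have "\<nexists>a. t = Leaf a" using t n by auto
  then obtain p s t2 where t2: "phi_graph p s t2" "sim t2 t" using ex_phi_graph[OF t'(1)] by blast
  have "set s = {1..n}" "motzkin p s"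
    using phi_graph_motzkin[OF t2(1)] leaf_labels_sim[OF t2(2)] t'(2) by auto
  then have ps: "(p, s) \<in> motzkin_paths n" using motzkin_paths_iff[OF n] by simp
  have "set s = {1..length s}"
    using \<open>set s = {1..n}\<close> \<open>motzkin p s\<close> length_distinct_upto by (auto simp: motzkin_def)
  then have Phi: "Phi (p, s) = t2" using phi_aux_eq[OF t2(1)] by (simp add: Phi_def)
  have "rep t2 (2 * n - 1)" using rep_cong_sim[OF sim_sym[OF t2(2)] t] .
  then have "Psi t2 = \<pi>"
    using Psi_eq_iff_rep[of t2] distinct_leaves_sim[OF t2(2)] leaf_labels_sim[OF t2(2)] t' by simp
  then show "\<pi> \<in> (Psi \<circ> Phi) ` motzkin_paths n" using ps Phi by (metis comp_apply imageI)
qed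

section \<open>Matchings on \<open>[2n]\<close> as matchings on \<open>[2n-2]\<close> with a chosen
  label\<close>

text \<open>\<open>k\<close> stands for the label of the marked vertex, with
  \<open>2 * n - 1\<close> for the root. It becomes the partner of \<open>2 * n\<close>, so
  \<open>k\<close> ranges over all of \<open>{1..2*n-1}\<close>.\<close>

definition extend_matching :: "nat \<Rightarrow> (nat \<Rightarrow> nat) \<Rightarrow> nat \<Rightarrow> nat \<Rightarrow> nat" where
  "extend_matching n \<pi> k i =
    (if k = 2 * n - 1 then (if i = 2 * n - 1 then 2 * n else if i = 2 * n then 2 * n - 1 else \<pi> i)
     else if i = k then 2 * n else if i = \<pi> k then 2 * n - 1
     else if i = 2 * n then k else if i = 2 * n - 1 then \<pi> k else \<pi> i)"

text \<open>Inverse construction: the two largest points are removed and the partners they leave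
  behind are joined. If the two are partners of each other, nothing else changes.\<close>

definition restrict_matching :: "nat \<Rightarrow> (nat \<Rightarrow> nat) \<Rightarrow> nat \<Rightarrow> nat" where
  "restrict_matching n \<rho> i =
    (if i = 2 * n - 1 \<or> i = 2 * n then i
     else if \<rho> i = 2 * n then \<rho> (2 * n - 1) else if \<rho> i = 2 * n - 1 then \<rho> (2 * n) else \<rho> i)"

lemma extend_matching_simps:
  assumes "1 \<le> n" "\<pi> \<in> matchings (2 * n - 2)" "k \<in> {1..2*n-2}"
  shows "extend_matching n \<pi> k k = 2 * n" "extend_matching n \<pi> k (\<pi> k) = 2 * n - 1"
    "extend_matching n \<pi> k (2 * n) = k" "extend_matching n \<pi> k (2 * n - 1) = \<pi> k"
    "i \<notin> {k, \<pi> k, 2 * n, 2 * n - 1} \<Longrightarrow> extend_matching n \<pi> k i = \<pi> i"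
  using assms matchingsD(1,2)[OF assms(2,3)] by (auto simp: extend_matching_def)

lemma extend_matching_top_simps:
  assumes "1 \<le> n"
  shows "extend_matching n \<pi> (2 * n - 1) (2 * n) = 2 * n - 1"
    "extend_matching n \<pi> (2 * n - 1) (2 * n - 1) = 2 * n"
    "i \<notin> {2 * n, 2 * n - 1} \<Longrightarrow> extend_matching n \<pi> (2 * n - 1) i = \<pi> i"
  using assms by (auto simp: extend_matching_def)

lemma extend_matching_in_matchings:
  assumes n: "1 \<le> n" and \<pi>: "\<pi> \<in> matchings (2 * n - 2)" and k: "k \<in> {1..2*n-1}"
  shows "extend_matching n \<pi> k \<in> matchings (2 * n)"
proof -
  note \<pi>D = matchingsD[OF \<pi>]
  let ?e = "extend_matching n \<pi> k"
  have "?e i \<in> {1..2*n} \<and> ?e i \<noteq> i \<and> ?e (?e i) = i" if i: "i \<in> {1..2*n}" for i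
  proof (cases "k = 2 * n - 1")
    case True
    note e = extend_matching_top_simps[OF n, where \<pi> = \<pi>, folded True]
    consider "i = 2 * n" | "i = 2 * n - 1" | "i \<in> {1..2*n-2}" using i by fastforce
    then show ?thesis
    proof cases
      case 3
      have small: "j \<notin> {2 * n, k} \<and> j \<in> {1..2*n}" if "j \<in> {1..2*n-2}" for j using that True by auto
      note i_small = small[OF 3] and \<pi>i_small = small[OF \<pi>D(1)[OF 3]]
      have "?e i = \<pi> i" "?e (\<pi> i) = \<pi> (\<pi> i)" using e(3) i_small \<pi>i_small by blast+
      then show ?thesis using \<pi>D(2)[OF 3] \<pi>D(3)[of i] \<pi>i_small by simp
    qed (use e n True in auto)
  next
    case False
    then have k': "k \<in> {1..2*n-2}" using k by auto
    note e = extend_matching_simps[OF n \<pi> k']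
    note l = \<pi>D(1,2)[OF k'] \<pi>D(3)[of k]
    consider "i \<in> {k, \<pi> k, 2 * n, 2 * n - 1}" | "i \<in> {1..2*n-2}" "i \<notin> {k, \<pi> k, 2 * n, 2 * n - 1}"
      using i by fastforce
    then show ?thesis
    proof cases
      case 1
      then show ?thesis using e(1-4) k' l n by auto
    next
      case 2
      have "\<pi> i \<in> {1..2*n-2}" using \<pi>D(1) 2(1) .
      moreover have "\<pi> i \<noteq> k" "\<pi> i \<noteq> \<pi> k" using 2(2) \<pi>D(3) by (metis insertI1 insertI2)+
      ultimately have "\<pi> i \<notin> {k, \<pi> k, 2 * n, 2 * n - 1}" "\<pi> i \<in> {1..2*n}" by auto
      then show ?thesis using e(5)[OF 2(2)] e(5)[of "\<pi> i"] \<pi>D(2)[OF 2(1)] \<pi>D(3) by simp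
    qed
  qed
  moreover have "?e i = i" if i: "i \<notin> {1..2*n}" for i
  proof -
    have "i \<notin> {1..2*n-2}" "i \<noteq> 2 * n" "i \<noteq> 2 * n - 1" "i \<noteq> k" using i n k by auto
    moreover have "i \<noteq> \<pi> k \<or> k = 2 * n - 1"
    proof (rule ccontr)
      assume *: "\<not> (i \<noteq> \<pi> k \<or> k = 2 * n - 1)"
      then have "k \<in> {1..2*n-2}" using k by auto
      then show False using \<pi>D(1)[of k] * \<open>i \<notin> {1..2*n-2}\<close> by simp
    qed
    ultimately show ?thesis using \<pi>D(4)[of i] by (auto simp: extend_matching_def)
  qed
  ultimately show ?thesis by (simp add: matchings_def)
qed

lemma restrict_extend_matching:
  assumes n: "1 \<le> n" and \<pi>: "\<pi> \<in> matchings (2 * n - 2)" and k: "k \<in> {1..2*n-1}"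
  shows "restrict_matching n (extend_matching n \<pi> k) = \<pi>" "extend_matching n \<pi> k (2 * n) = k"
proof -
  note \<pi>D = matchingsD[OF \<pi>]
  have big: "\<pi> (2 * n) = 2 * n" "\<pi> (2 * n - 1) = 2 * n - 1" by (rule \<pi>D(4); use n in auto)+
  have \<pi>_big: "\<pi> i \<noteq> 2 * n \<and> \<pi> i \<noteq> 2 * n - 1" if "i \<notin> {2 * n, 2 * n - 1}" for i
    using that big \<pi>D(3) by (metis insertCI)
  show "extend_matching n \<pi> k (2 * n) = k"
    using extend_matching_top_simps(1)[OF n] extend_matching_simps(3)[OF n \<pi>] k
    by (cases "k = 2 * n - 1") auto
  show "restrict_matching n (extend_matching n \<pi> k) = \<pi>"
  proof
    fix i
    show "restrict_matching n (extend_matching n \<pi> k) i = \<pi> i"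
    proof (cases "i \<in> {2 * n, 2 * n - 1}")
      case True
      then show ?thesis using big by (auto simp: restrict_matching_def)
    next
      case i: False
      show ?thesis
      proof (cases "k = 2 * n - 1")
        case True
        note e = extend_matching_top_simps[OF n, where \<pi> = \<pi>, folded True]
        show ?thesis using e(3)[of i] i \<pi>_big[OF i] True by (simp add: restrict_matching_def)
      next
        case False
        then have k': "k \<in> {1..2*n-2}" using k by auto
        note e = extend_matching_simps[OF n \<pi> k']
        consider "i = k" | "i = \<pi> k" | "i \<notin> {k, \<pi> k, 2 * n, 2 * n - 1}" using i by auto
        then show ?thesis
        proof cases
          case 1
          then show ?thesis using e(1,4) i by (simp add: restrict_matching_def)
        next
          case 2
          then show ?thesis using e(2,3) i n \<pi>D(3) by (simp add: restrict_matching_def)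
        next
          case 3
          then show ?thesis using e(5)[OF 3] i \<pi>_big[OF i] by (simp add: restrict_matching_def)
        qed
      qed
    qed
  qed
qed

lemma restrict_matching_in_matchings:
  assumes n: "1 \<le> n" and \<rho>: "\<rho> \<in> matchings (2 * n)"
  shows "restrict_matching n \<rho> \<in> matchings (2 * n - 2)"
proof -
  note \<rho>D = matchingsD[OF \<rho>]
  let ?r = "restrict_matching n \<rho>"
  have top: "\<rho> (2 * n) \<in> {1..2*n}" "\<rho> (2 * n - 1) \<in> {1..2*n}" "\<rho> (2 * n) \<noteq> 2 * n"
    "\<rho> (2 * n - 1) \<noteq> 2 * n - 1" using \<rho>D(1,2) n by auto
  have "?r i \<in> {1..2*n-2} \<and> ?r i \<noteq> i \<and> ?r (?r i) = i" if i: "i \<in> {1..2*n-2}" for i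
  proof -
    have i': "i \<in> {1..2*n}" "i \<noteq> 2 * n" "i \<noteq> 2 * n - 1" using i by auto
    have inR: "\<rho> i \<in> {1..2*n}" "\<rho> i \<noteq> i" "\<rho> (\<rho> i) = i" using \<rho>D i' by auto
    consider "\<rho> i = 2 * n" | "\<rho> i = 2 * n - 1" | "\<rho> i \<noteq> 2 * n" "\<rho> i \<noteq> 2 * n - 1" by blast
    then show ?thesis
    proof cases
      case 1
      then have i_eq: "i = \<rho> (2 * n)" using inR by simp
      have ri: "?r i = \<rho> (2 * n - 1)" using i' 1 by (simp add: restrict_matching_def)
      \<comment> \<open>Otherwise the two largest points would be partners and \<open>i\<close>
        would be \<open>2 * n - 1\<close>.\<close>
      have l: "\<rho> (2 * n - 1) \<noteq> 2 * n" using i_eq i' \<rho>D(3)[of "2 * n - 1"] by auto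
      then have "\<rho> (2 * n - 1) \<in> {1..2*n-2}" using top by auto
      moreover have "\<rho> (2 * n - 1) \<noteq> i" using 1 \<rho>D(3)[of "2 * n - 1"] n by auto
      moreover have "?r (\<rho> (2 * n - 1)) = i"
        using l top(4) \<rho>D(3)[of "2 * n - 1"] n i_eq by (simp add: restrict_matching_def)
      ultimately show ?thesis using ri by simp
    next
      case 2
      then have i_eq: "i = \<rho> (2 * n - 1)" using inR by simp
      have ri: "?r i = \<rho> (2 * n)" using i' 2 n by (simp add: restrict_matching_def)
      have l: "\<rho> (2 * n) \<noteq> 2 * n - 1" using i_eq i' \<rho>D(3)[of "2 * n"] by auto
      then have "\<rho> (2 * n) \<in> {1..2*n-2}" using top by auto
      moreover have "\<rho> (2 * n) \<noteq> i" using 2 \<rho>D(3)[of "2 * n"] n by auto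
      moreover have "?r (\<rho> (2 * n)) = i"
        using l top(3) \<rho>D(3)[of "2 * n"] n i_eq by (simp add: restrict_matching_def)
      ultimately show ?thesis using ri by simp
    next
      case 3
      then have ri: "?r i = \<rho> i" using i' by (simp add: restrict_matching_def)
      have "\<rho> i \<in> {1..2*n-2}" using 3 inR by auto
      moreover have "?r (\<rho> i) = i" using 3 inR i' by (simp add: restrict_matching_def)
      ultimately show ?thesis using ri inR by simp
    qed
  qed
  moreover have "?r i = i" if i: "i \<notin> {1..2*n-2}" for i
  proof (cases "i = 2 * n - 1 \<or> i = 2 * n")
    case False
    then have "i \<notin> {1..2*n}" using i by auto
    then have "\<rho> i = i" using \<rho>D(4) by simp
    then show ?thesis using False by (simp add: restrict_matching_def)
  qed (simp add: restrict_matching_def)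
  ultimately show ?thesis by (simp add: matchings_def)
qed

lemma extend_restrict_matching:
  assumes n: "1 \<le> n" and \<rho>: "\<rho> \<in> matchings (2 * n)"
  shows "extend_matching n (restrict_matching n \<rho>) (\<rho> (2 * n)) = \<rho>" "\<rho> (2 * n) \<in> {1..2*n-1}"
proof -
  note \<rho>D = matchingsD[OF \<rho>]
  let ?r = "restrict_matching n \<rho>" let ?k = "\<rho> (2 * n)"
  have top: "?k \<in> {1..2*n}" "?k \<noteq> 2 * n" "\<rho> ?k = 2 * n" using \<rho>D(1-3) n by auto
  then show k: "?k \<in> {1..2*n-1}" by auto
  have inj: "\<rho> i = \<rho> j \<longleftrightarrow> i = j" for i j using \<rho>D(3) by metis
  show "extend_matching n ?r ?k = \<rho>"
  proof (cases "?k = 2 * n - 1")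
    case True
    then have l: "\<rho> (2 * n - 1) = 2 * n" using top by simp
    show ?thesis
    proof
      fix i
      show "extend_matching n ?r ?k i = \<rho> i"
        using inj[of i "2 * n"] inj[of i "2 * n - 1"] True l
        by (auto simp: extend_matching_def restrict_matching_def)
    qed
  next
    case False
    \<comment> \<open>The restriction joins \<open>?k\<close> to the former partner of
      \<open>2 * n - 1\<close>, which is why extending by \<open>?k\<close> alone restores both
      pairs.\<close>
    then have rk: "?r ?k = \<rho> (2 * n - 1)" using top by (simp add: restrict_matching_def)
    have l: "\<rho> (\<rho> (2 * n - 1)) = 2 * n - 1" by (rule \<rho>D(3))
    show ?thesis
    proof
      fix i
      consider "i = ?k" | "i = \<rho> (2 * n - 1)" "i \<noteq> ?k" | "i = 2 * n" "i \<noteq> ?k" "i \<noteq> \<rho> (2 * n - 1)"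
        | "i = 2 * n - 1" "i \<noteq> ?k" "i \<noteq> \<rho> (2 * n - 1)" "i \<noteq> 2 * n"
        | "i \<noteq> 2 * n - 1" "i \<noteq> ?k" "i \<noteq> \<rho> (2 * n - 1)" "i \<noteq> 2 * n" by blast
      then show "extend_matching n ?r ?k i = \<rho> i"
      proof cases
        case 5
        then have "\<rho> i \<noteq> 2 * n" "\<rho> i \<noteq> 2 * n - 1" using \<rho>D(3)[of i] by metis+
        then show ?thesis using 5 False rk by (simp add: extend_matching_def restrict_matching_def)
      qed (use False rk l top in \<open>simp_all add: extend_matching_def\<close>)
    qed
  qed
qed

text \<open>As \<open>L\<close> gives the root the label \<open>2 * n - 1\<close>, both cases of
  \<open>Psi'\<close> are governed by the single parameter \<open>L q\<close>.\<close>

lemma Psi'_eq_extend: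
  assumes L: "valid_lab n t L"
    and lab: "\<And>q. q \<in> positions t \<Longrightarrow> q \<noteq> [] \<Longrightarrow> full_lab t q = Some (L q)"
    and n: "nleaves t = n" and q: "q \<in> positions t"
  shows "Psi' (t, q) = extend_matching n (Psi t) (L q)"
proof (cases "q = []")
  case True
  then show ?thesis
    using valid_labD(2)[OF L] by (simp add: Psi'_def extend_matching_def Let_def n fun_eq_iff)
next
  case False
  obtain r x where r: "q = r @ [x]" "r \<in> inner t" by (rule positions_snocE[OF q False])
  have "L q \<in> {1..2*n-2}" using valid_lab_child_range[OF L r(2)] r(1) by simp
  then have "L q \<noteq> 2 * n - 1" by auto
  moreover have "full_lab t (sibling q) = Some (Psi t (L q))"
    using lab[of "sibling q"] r siblings_pairedD(1)[OF Psi_siblings_paired[OF L lab] r(2), of x]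
    by simp
  ultimately show ?thesis
    using False lab[OF q False] by (simp add: Psi'_def extend_matching_def Let_def n fun_eq_iff)
qed

lemma Psi'_Phi'_bij:
  assumes n: "1 \<le> n"
  shows "bij_betw (Psi' \<circ> Phi') (positive_paths n) (matchings (2 * n))"
  unfolding bij_betw_def
proof (intro conjI inj_onI equalityI subsetI)
  fix x y assume xy: "x \<in> positive_paths n" "y \<in> positive_paths n" "(Psi' \<circ> Phi') x = (Psi' \<circ> Phi') y"
  obtain p s p' s' where x: "x = (p, s)" and y: "y = (p', s')" by (cases x, cases y)
  obtain t q where tq: "Phi' x = (t, q)" "phi'_graph p s t q" "leaf_labels t = {1..n}"
    "distinct_leaves t" "q \<in> positions t"
    using Phi'_phi'_graph[OF n xy(1)[unfolded x]] unfolding x by blast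
  obtain t' q' where tq': "Phi' y = (t', q')" "phi'_graph p' s' t' q'" "leaf_labels t' = {1..n}"
    "distinct_leaves t'" "q' \<in> positions t'"
    using Phi'_phi'_graph[OF n xy(2)[unfolded y]] unfolding y by blast
  obtain L where L: "valid_lab n t L"
    and lab: "\<And>q. q \<in> positions t \<Longrightarrow> q \<noteq> [] \<Longrightarrow> full_lab t q = Some (L q)"
    using full_lab_valid[OF tq(4,3)] by blast
  obtain L' where L': "valid_lab n t' L'"
    and lab': "\<And>q. q \<in> positions t' \<Longrightarrow> q \<noteq> [] \<Longrightarrow> full_lab t' q = Some (L' q)"
    using full_lab_valid[OF tq'(4,3)] by blast
  have nl: "nleaves t = n" "nleaves t' = n"
    using card_leaf_labels[OF tq(4)] card_leaf_labels[OF tq'(4)] tq(3) tq'(3) by auto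
  have k: "L q \<in> {1..2*n-1}" "L' q' \<in> {1..2*n-1}"
    using valid_labD(1)[OF L] valid_labD(1)[OF L'] tq(5) tq'(5) by (auto simp: bij_betw_def)
  have "extend_matching n (Psi t) (L q) = extend_matching n (Psi t') (L' q')"
    using xy(3) tq(1) tq'(1) Psi'_eq_extend[OF L lab nl(1) tq(5)] Psi'_eq_extend[OF L' lab' nl(2) tq'(5)]
    by simp
  \<comment> \<open>Restricting returns the matching, and the value at \<open>2 * n\<close> returns
    the label of the mark.\<close>
  then have eq: "Psi t = Psi t'" "L q = L' q'"
    using restrict_extend_matching[OF n Psi_matching[OF tq(4,3)] k(1)]
      restrict_extend_matching[OF n Psi_matching[OF tq'(4,3)] k(2)] by auto
  define \<pi> where "\<pi> = Psi t"
  interpret merge_order n \<pi> "greedy \<pi> n"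
    unfolding \<pi>_def by (rule merge_order_exists[OF Psi_matching[OF tq(4,3)]])
  have paired: "siblings_paired n t L \<pi>" "siblings_paired n t' L' \<pi>"
    using Psi_siblings_paired[OF L lab] Psi_siblings_paired[OF L' lab'] eq(1) by (auto simp: \<pi>_def)
  have "sim t t'"
    using valid_lab_rep[OF L paired(1), of "[]"] valid_lab_rep[OF L' paired(2), of "[]"]
      valid_labD(2)[OF L] valid_labD(2)[OF L'] rep_imp_sim by auto
  \<comment> \<open>Equal labels under one \<pi> have similar subtrees, and their common leaf set is
    the form in which \<open>phi'_graph_inj\<close> knows the mark.\<close>
  moreover have "sim (subtree_at t q) (subtree_at t' q')"
    using valid_lab_rep[OF L paired(1) tq(5)] valid_lab_rep[OF L' paired(2) tq'(5)] eq(2) rep_imp_sim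
    by metis
  ultimately show "x = y" using phi'_graph_inj[OF tq(2) tq'(2)] leaf_labels_sim unfolding x y
    by blast
next
  fix \<rho> assume "\<rho> \<in> (Psi' \<circ> Phi') ` positive_paths n"
  then obtain p s where ps: "(p, s) \<in> positive_paths n" "\<rho> = Psi' (Phi' (p, s))" by auto
  obtain t q where tq: "Phi' (p, s) = (t, q)" "leaf_labels t = {1..n}"
    "distinct_leaves t" "q \<in> positions t"
    using Phi'_phi'_graph[OF n ps(1)] by blast
  obtain L where L: "valid_lab n t L"
    and lab: "\<And>q. q \<in> positions t \<Longrightarrow> q \<noteq> [] \<Longrightarrow> full_lab t q = Some (L q)"
    using full_lab_valid[OF tq(3,2)] by blast
  have nl: "nleaves t = n" using card_leaf_labels[OF tq(3)] tq(2) by simp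
  have "L q \<in> {1..2*n-1}" using valid_labD(1)[OF L] tq(4) by (auto simp: bij_betw_def)
  then have "extend_matching n (Psi t) (L q) \<in> matchings (2 * n)"
    by (rule extend_matching_in_matchings[OF n Psi_matching[OF tq(3,2)]])
  then show "\<rho> \<in> matchings (2 * n)"
    using Psi'_eq_extend[OF L lab nl tq(4)] ps(2) tq(1) by simp
next
  fix \<rho> assume \<rho>: "\<rho> \<in> matchings (2 * n)"
  define \<pi> k where "\<pi> = restrict_matching n \<rho>" and "k = \<rho> (2 * n)"
  interpret merge_order n \<pi> "greedy \<pi> n"
    unfolding \<pi>_def by (rule merge_order_exists[OF restrict_matching_in_matchings[OF n \<rho>]])
  obtain t where t: "rep t (2 * n - 1)" using rep_exists[of "2 * n - 1"] n by fastforce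
  let ?L = "\<lambda>q. vertex_label (subtree_at t q)"
  note t_lab = rep_labelling[OF t n]
  have k: "k \<in> {1..2*n-1}" unfolding k_def by (rule extend_restrict_matching(2)[OF n \<rho>])
  then have "k \<in> ?L ` positions t" using valid_labD(1)[OF t_lab(1)] unfolding bij_betw_def by blast
  then obtain q where q: "q \<in> positions t" "k = ?L q" by blast
  obtain p s t2 q2 where t2: "phi'_graph p s t2 q2" "sim t2 t"
    "leaf_labels (subtree_at t2 q2) = leaf_labels (subtree_at t q)"
    using ex_phi'_graph[OF t_lab(3) q(1)] by blast
  have t2': "distinct_leaves t2" "leaf_labels t2 = {1..n}" "q2 \<in> positions t2"
    using distinct_leaves_sim[OF t2(2)] leaf_labels_sim[OF t2(2)] t_lab(3,4) phi'_graph_positive[OF t2(1)] by auto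
  have "set s = {1..n}" "positive p s" using phi'_graph_positive[OF t2(1)] t2'(2) by auto
  then have ps: "(p, s) \<in> positive_paths n" using positive_paths_iff[OF n] by simp
  have "set s = {1..length s}"
    using \<open>set s = {1..n}\<close> \<open>positive p s\<close> length_distinct_upto by (auto simp: positive_def)
  then have Phi': "Phi' (p, s) = (t2, q2)" using phi'_aux_eq[OF t2(1)] by (simp add: Phi'_def)
  have rep2: "rep t2 (2 * n - 1)" using rep_cong_sim[OF sim_sym[OF t2(2)] t] .
  then have Psi: "Psi t2 = \<pi>" using Psi_eq_iff_rep[OF t2'(1,2)] by simp
  obtain L where L: "valid_lab n t2 L"
    and lab: "\<And>q. q \<in> positions t2 \<Longrightarrow> q \<noteq> [] \<Longrightarrow> full_lab t2 q = Some (L q)"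
    using full_lab_valid[OF t2'(1,2)] by blast
  have paired: "siblings_paired n t2 L \<pi>" using Psi_siblings_paired[OF L lab] Psi by simp
  \<comment> \<open>The label \<open>k\<close> was located in \<open>t\<close>, but the path yields
    \<open>t2\<close> with its own labelling. The vertex \<open>q1\<close> labelled \<open>k\<close>
    there has the same leaf set as the marked \<open>q2\<close>, and leaf sets determine
    positions.\<close>
  have "k \<in> L ` positions t2" using valid_labD(1)[OF L] k unfolding bij_betw_def by blast
  then obtain q1 where q1: "q1 \<in> positions t2" "k = L q1" by blast
  have "sim (subtree_at t2 q1) (subtree_at t q)"
    using valid_lab_rep[OF L paired q1(1)] t_lab(5)[OF q(1)] q(2) q1(2) rep_imp_sim by metis
  then have "leaf_labels (subtree_at t2 q1) = leaf_labels (subtree_at t2 q2)"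
    using leaf_labels_sim t2(3) by simp
  then have "q1 = q2" using subtree_at_inj[OF t2'(1) q1(1) t2'(3)] by simp
  then have "L q2 = k" using q1 by simp
  moreover have "nleaves t2 = n" using card_leaf_labels[OF t2'(1)] t2'(2) by simp
  ultimately have "Psi' (t2, q2) = extend_matching n \<pi> k"
    using Psi'_eq_extend[OF L lab _ t2'(3)] Psi by simp
  also have "\<dots> = \<rho>" unfolding \<pi>_def k_def by (rule extend_restrict_matching(1)[OF n \<rho>])
  finally show "\<rho> \<in> (Psi' \<circ> Phi') ` positive_paths n" using ps Phi' by (metis comp_apply imageI)
qed

theorem theorem3:
  shows "(\<forall>n::nat. n \<ge> 2 \<longrightarrow>
            bij_betw (Psi \<circ> Phi) (motzkin_paths n) (matchings (2 * n - 2)))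
       \<and> (\<forall>n::nat. n \<ge> 1 \<longrightarrow>
            bij_betw (Psi' \<circ> Phi') (positive_paths n) (matchings (2 * n)))"
  using Psi_Phi_bij Psi'_Phi'_bij by blast

end
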